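(* Let $0<\epsilon\leq1$ and let $(G,L)$ be a $(1+\epsilon)\Delta$-extra-color vertex-list-coloring instance, where $\Delta$ is the maximum degree of $G$ and $\frac{\ln(\Delta)+2}{\Delta}\leq\frac{\epsilon^2}{40}$. Let $(X,\pi_{n-1})$ be its associated weighted simplicial complex. Then for any $2\leq k\leq n$ and any face $\tau\in X$ of co-dimension $k$, $\lambda_2(P_\tau)\leq\frac{5/(2\epsilon)}{k-1}$.
   Context: $G=(V,E)$ is a finite simple graph with $n=|V|$, degrees $\Delta_G(v)$ and maximum degree $\Delta$. A vertex-list-coloring instance $(G,L)$ assigns to each $v\in V$ a finite set $L(v)\subseteq[q]$; a proper $L$-vertex-list-coloring is $\sigma:V\to[q]$ with $\sigma(v)\in L(v)$ and $\sigma(u)\neq\sigma(v)$ for adjacent $u,v$. It is $\beta$-extra-color if $|L(v)|\geq\beta+\Delta_G(v)$ for all $v$. Write $vc$ for the pair $(v,c)$. The associated complex $X=X(G,L)$ is the pure $(n-1)$-dimensional simplicial complex whose facets are the sets $\{v\sigma(v):v\in V\}$ for proper $L$-vertex-list-colorings $\sigma$ (faces are all subsets of facets), and $\pi_{n-1}$ is the uniform distribution on facets. For a face $\tau$, $\mathrm{codim}(\tau)=n-|\tau|$ and $X_\tau(0)=\{x\notin\tau:\tau\cup\{x\}\in X\}$. For $\tau$ of co-dimension $k\geq2$, the local walk $P_\tau$ on $X_\tau(0)$ is $P_\tau(x,y)=\frac1{k-1}\Pr_{\sigma\sim\pi_{n-1}}[y\in\sigma\mid\sigma\supseteq\tau\cup\{x\}]$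 for distinct $x,y\in X_\tau(0)$ and $P_\tau(x,x)=0$; it is reversible w.r.t. $\pi_\tau(x)=\frac1k\Pr[x\in\sigma\mid\sigma\supseteq\tau]$, and $\lambda_2(P_\tau)$ is its second largest eigenvalue. *)

theory Defs
  imports "HOL-Probability.Probability" "Jordan_Normal_Form.Char_Poly"
begin

definition simple_graph :: "'v set \<Rightarrow> 'v set set \<Rightarrow> bool" where
  "simple_graph V E \<longleftrightarrow> finite V \<and> (\<forall>e\<in>E. e \<subseteq> V \<and> card e = 2)"

definition vdeg :: "'v set set \<Rightarrow> 'v \<Rightarrow> nat" where
  "vdeg E v = card {u. {u, v} \<in> E}"

definition max_deg :: "'v set \<Rightarrow> 'v set set \<Rightarrow> nat" where
  "max_deg V E = Max (vdeg E ` V)"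

definition list_coloring_instance ::
  "'v set \<Rightarrow> 'v set set \<Rightarrow> nat \<Rightarrow> ('v \<Rightarrow> nat set) \<Rightarrow> bool" where
  "list_coloring_instance V E q L \<longleftrightarrow> simple_graph V E \<and> (\<forall>v\<in>V. L v \<subseteq> {1..q})"

definition extra_color ::
  "'v set \<Rightarrow> 'v set set \<Rightarrow> ('v \<Rightarrow> nat set) \<Rightarrow> real \<Rightarrow> bool" where
  "extra_color V E L \<beta> \<longleftrightarrow> (\<forall>v\<in>V. real (card (L v)) \<ge> \<beta> + real (vdeg E v))"

definition proper_colorings ::
  "'v set \<Rightarrow> 'v set set \<Rightarrow> nat \<Rightarrow> ('v \<Rightarrow> nat set) \<Rightarrow> ('v \<Rightarrow> nat) set" where
  "proper_colorings V E q L =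
     {\<sigma> \<in> V \<rightarrow>\<^sub>E {1..q}. (\<forall>v\<in>V. \<sigma> v \<in> L v) \<and> (\<forall>u v. {u, v} \<in> E \<longrightarrow> \<sigma> u \<noteq> \<sigma> v)}"

definition facets ::
  "'v set \<Rightarrow> 'v set set \<Rightarrow> nat \<Rightarrow> ('v \<Rightarrow> nat set) \<Rightarrow> ('v \<times> nat) set set" where
  "facets V E q L = (\<lambda>\<sigma>. (\<lambda>v. (v, \<sigma> v)) ` V) ` proper_colorings V E q L"

definition coloring_complex ::
  "'v set \<Rightarrow> 'v set set \<Rightarrow> nat \<Rightarrow> ('v \<Rightarrow> nat set) \<Rightarrow> ('v \<times> nat) set set" where
  "coloring_complex V E q L = {\<tau>. \<exists>F \<in> facets V E q L. \<tau> \<subseteq> F}"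

definition facet_pmf ::
  "'v set \<Rightarrow> 'v set set \<Rightarrow> nat \<Rightarrow> ('v \<Rightarrow> nat set) \<Rightarrow> ('v \<times> nat) set pmf" where
  "facet_pmf V E q L = pmf_of_set (facets V E q L)"

definition codim :: "'v set \<Rightarrow> ('v \<times> nat) set \<Rightarrow> nat" where
  "codim V \<tau> = card V - card \<tau>"

definition link_vertices ::
  "'v set \<Rightarrow> 'v set set \<Rightarrow> nat \<Rightarrow> ('v \<Rightarrow> nat set) \<Rightarrow> ('v \<times> nat) set \<Rightarrow> ('v \<times> nat) set" where
  "link_vertices V E q L \<tau> = {x. x \<notin> \<tau> \<and> \<tau> \<union> {x} \<in> coloring_complex V E q L}"

text \<open>Only meaningful for \<open>codim V \<tau> \<ge> 2\<close> and \<open>x, y \<in> link_vertices V E q L \<tau>\<close>; the event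
  conditioned on then has positive probability.\<close>

definition local_walk ::
  "'v set \<Rightarrow> 'v set set \<Rightarrow> nat \<Rightarrow> ('v \<Rightarrow> nat set) \<Rightarrow> ('v \<times> nat) set \<Rightarrow>
     'v \<times> nat \<Rightarrow> 'v \<times> nat \<Rightarrow> real" where
  "local_walk V E q L \<tau> x y =
     (if x = y then 0
      else 1 / (real (codim V \<tau>) - 1) *
           \<P>(\<sigma> in measure_pmf (facet_pmf V E q L). y \<in> \<sigma> \<bar> \<tau> \<union> {x} \<subseteq> \<sigma>))"

text \<open>The matrix of a kernel \<open>P\<close> on a finite set \<open>S\<close>. A different enumeration of \<open>S\<close> conjugates
  the matrix by a permutation matrix, so the eigenvalues do not depend on the choice.\<close>

definition enumeration :: "'a set \<Rightarrow> 'a list" where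
  "enumeration S = (SOME xs. distinct xs \<and> set xs = S)"

definition kernel_matrix :: "'a set \<Rightarrow> ('a \<Rightarrow> 'a \<Rightarrow> real) \<Rightarrow> real mat" where
  "kernel_matrix S P =
     mat (card S) (card S) (\<lambda>(i, j). P (enumeration S ! i) (enumeration S ! j))"

text \<open>The real eigenvalues with algebraic multiplicity, largest first. A kernel that is reversible
  with respect to a positive distribution is diagonalizable over the reals, so for it the list has
  length \<open>card S\<close> and the algebraic and geometric multiplicities agree. The second entry (index 1)
  is meaningful when \<open>card S \<ge> 2\<close>, which holds for the link of a face of codimension at least 2.\<close>

definition eigenvalue_list :: "'a set \<Rightarrow> ('a \<Rightarrow> 'a \<Rightarrow> real) \<Rightarrow> real list" where
  "eigenvalue_list S P = rev (sorted_list_of_multiset (proots (char_poly (kernel_matrix S P))))"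

definition lambda2 :: "'a set \<Rightarrow> ('a \<Rightarrow> 'a \<Rightarrow> real) \<Rightarrow> real" where
  "lambda2 S P = eigenvalue_list S P ! 1"

end

theory Submission
  imports Defs
begin

text \<open>
  The local walk at a face is governed by the pairwise influences of the residual colouring
  instance. If every list exceeds the residual degree by at least \<open>\<beta> = (1 + \<epsilon>) \<Delta>\<close>, then every
  marginal is at most \<open>1/\<beta>\<close>. To compare the measures with \<open>v\<close> pinned to \<open>c\<close> and to \<open>c'\<close>, remove
  \<open>v\<close> and exchange the forbidden colour \<open>c\<close> for \<open>c'\<close> at one neighbour \<open>w\<close> after the other: each
  exchange moves mass at most \<open>1/\<beta>\<close> at \<open>w\<close>, and the effect on the other vertices is bounded by
  induction. So a bound \<open>I\<close> on the total \<open>\<ell>\<^sub>1\<close> influence propagates as soon as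
  \<open>\<Delta> (2 + I) / \<beta> \<le> I\<close>, which holds for \<open>I = 2/\<epsilon>\<close>. A left eigenvector of the walk with total
  mass 0 and a nonnegative eigenvalue has mass 0 in every vertex block, hence its eigenvalue is
  at most \<open>I / (k - 1)\<close>.
\<close>

section \<open>Influences in list colourings\<close>

text \<open>All negative mass of \<open>\<gamma>\<close> sits at \<open>d\<close> and has size at
  most \<open>t\<close>, so the absolute values of \<open>\<gamma>\<close> add up to
  \<open>2 * (- \<gamma> d)\<close>. As the coefficients sum to 0, \<open>F d\<close> can be
  subtracted from every component of the mixture; each unit of mass away from \<open>d\<close> then
  costs at most \<open>I\<close>.\<close>

lemma sum_abs_signed_mixture_le:
  fixes \<gamma> :: "'a \<Rightarrow> real" and F :: "'a \<Rightarrow> 'i \<Rightarrow> real"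
  assumes fin: "finite B" and d: "d \<in> B" and sum0: "(\<Sum>b\<in>B. \<gamma> b) = 0"
    and pos: "\<And>b. b \<in> B \<Longrightarrow> b \<noteq> d \<Longrightarrow> 0 \<le> \<gamma> b" and t: "- \<gamma> d \<le> t" and I: "0 \<le> I"
    and F: "\<And>b. b \<in> B \<Longrightarrow> \<gamma> b \<noteq> 0 \<Longrightarrow> \<gamma> d \<noteq> 0 \<Longrightarrow> (\<Sum>i\<in>T. \<bar>F b i - F d i\<bar>) \<le> I"
  shows "(\<Sum>b\<in>B. \<bar>\<gamma> b\<bar>) + (\<Sum>i\<in>T. \<bar>\<Sum>b\<in>B. \<gamma> b * F b i\<bar>) \<le> t * (2 + I)"
proof -
  let ?B = "B - {d}"
  have sum_rest: "(\<Sum>b\<in>?B. \<gamma> b) = - \<gamma> d"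
    using sum0 sum.remove[OF fin d, of \<gamma>] by simp
  have "0 \<le> (\<Sum>b\<in>?B. \<gamma> b)" using pos by (intro sum_nonneg) auto
  then have neg: "\<gamma> d \<le> 0" using sum_rest by simp
  have "(\<Sum>b\<in>?B. \<bar>\<gamma> b\<bar>) = (\<Sum>b\<in>?B. \<gamma> b)" using pos by (intro sum.cong) auto
  then have 1: "(\<Sum>b\<in>B. \<bar>\<gamma> b\<bar>) = 2 * (- \<gamma> d)"
    using sum.remove[OF fin d, of "\<lambda>b. \<bar>\<gamma> b\<bar>"] sum_rest neg by simp
  have mix: "(\<Sum>b\<in>B. \<gamma> b * F b i) = (\<Sum>b\<in>?B. \<gamma> b * (F b i - F d i))" for i
  proof -
    have "(\<Sum>b\<in>?B. \<gamma> b * (F b i - F d i)) = (\<Sum>b\<in>?B. \<gamma> b * F b i) - (\<Sum>b\<in>?B. \<gamma> b) * F d i"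
      by (simp add: right_diff_distrib sum_subtractf sum_distrib_right)
    then show ?thesis using sum.remove[OF fin d, of "\<lambda>b. \<gamma> b * F b i"] sum_rest by simp
  qed
  have "(\<Sum>i\<in>T. \<bar>\<Sum>b\<in>B. \<gamma> b * F b i\<bar>) \<le> (\<Sum>i\<in>T. \<Sum>b\<in>?B. \<gamma> b * \<bar>F b i - F d i\<bar>)"
    unfolding mix
    by (intro sum_mono order_trans[OF sum_abs]) (use pos in \<open>simp add: abs_mult\<close>)
  also have "\<dots> = (\<Sum>b\<in>?B. \<gamma> b * (\<Sum>i\<in>T. \<bar>F b i - F d i\<bar>))"
    by (subst sum.swap) (simp add: sum_distrib_left)
  also have "\<dots> \<le> (\<Sum>b\<in>?B. \<gamma> b * I)"
  proof (rule sum_mono)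
    fix b assume b: "b \<in> ?B"
    show "\<gamma> b * (\<Sum>i\<in>T. \<bar>F b i - F d i\<bar>) \<le> \<gamma> b * I"
    \<comment> \<open>A vanishing coefficient at \<open>d\<close> forces all others to vanish, as
      they are nonnegative and the total is 0.\<close>
    proof (cases "\<gamma> d = 0")
      case True
      then have "\<gamma> b = 0"
        using sum_rest fin b pos sum_nonneg_eq_0_iff[of ?B \<gamma>] by auto
      then show ?thesis by simp
    next
      case False
      then show ?thesis using F[of b] b pos[of b] by (cases "\<gamma> b = 0") (auto intro: mult_left_mono)
    qed
  qed
  also have "\<dots> = - \<gamma> d * I" using sum_rest by (simp flip: sum_distrib_right)
  finally have "(\<Sum>b\<in>B. \<bar>\<gamma> b\<bar>) + (\<Sum>i\<in>T. \<bar>\<Sum>b\<in>B. \<gamma> b * F b i\<bar>) \<le> (- \<gamma> d) * (2 + I)"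
    unfolding 1 by (simp add: algebra_simps)
  also have "\<dots> \<le> t * (2 + I)" using t I by (intro mult_right_mono) auto
  finally show ?thesis .
qed

text \<open>\<open>N\<close> gives the neighbourhoods, \<open>C\<close> the palette and
  \<open>\<beta>\<close> the surplus of colours. The vertex set \<open>U\<close> is a parameter of
  the definitions below, so deleting a vertex changes \<open>U\<close> while the graph stays
  fixed.\<close>

locale list_coloring =
  fixes N :: "'v \<Rightarrow> 'v set" and C :: "nat set" and \<beta> :: real
  assumes N_sym: "u \<in> N v \<longleftrightarrow> v \<in> N u"
    and N_irrefl: "v \<notin> N v"
    and finite_C: "finite C"
    and \<beta>_pos: "0 < \<beta>"
begin

definition colorings :: "'v set \<Rightarrow> ('v \<Rightarrow> nat set) \<Rightarrow> ('v \<Rightarrow> nat) set" where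
  "colorings U M = {\<sigma> \<in> Pi\<^sub>E U M. \<forall>u\<in>U. \<forall>w\<in>U. w \<in> N u \<longrightarrow> \<sigma> u \<noteq> \<sigma> w}"

text \<open>The residual lists once \<open>v\<close> has received \<open>c\<close>. On
  \<open>U - {v}\<close> they describe the colourings conditioned on colour \<open>c\<close> at
  \<open>v\<close>.\<close>

definition pin :: "('v \<Rightarrow> nat set) \<Rightarrow> 'v \<Rightarrow> nat \<Rightarrow> 'v \<Rightarrow> nat set" where
  "pin M v c = (\<lambda>w. if w \<in> N v then M w - {c} else M w)"

definition prob :: "'v set \<Rightarrow> ('v \<Rightarrow> nat set) \<Rightarrow> 'v \<Rightarrow> nat \<Rightarrow> real" where
  "prob U M u b = real (card {\<sigma> \<in> colorings U M. \<sigma> u = b}) / real (card (colorings U M))"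

text \<open>Degrees are counted inside \<open>U\<close>: a deleted neighbour lowers the requirement
  by 1, which pays for the colour it may block.\<close>

definition extra :: "'v set \<Rightarrow> ('v \<Rightarrow> nat set) \<Rightarrow> bool" where
  "extra U M \<longleftrightarrow> finite U \<and>
     (\<forall>w\<in>U. M w \<subseteq> C \<and> \<beta> + real (card (N w \<inter> U)) \<le> real (card (M w)))"

text \<open>The sum runs over the whole palette, so that two list assignments are compared over one
  index set; colours outside a list have marginal 0.\<close>

definition dist1 :: "'v set \<Rightarrow> ('v \<Rightarrow> nat set) \<Rightarrow> ('v \<Rightarrow> nat set) \<Rightarrow> real" where
  "dist1 U M M' = (\<Sum>u\<in>U. \<Sum>b\<in>C. \<bar>prob U M u b - prob U M' u b\<bar>)"

lemma extra_finite: "extra U M \<Longrightarrow> finite U"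
  by (simp add: extra_def)

lemma extra_subset: "extra U M \<Longrightarrow> w \<in> U \<Longrightarrow> M w \<subseteq> C"
  by (simp add: extra_def)

lemma extra_finite_list: "extra U M \<Longrightarrow> w \<in> U \<Longrightarrow> finite (M w)"
  by (rule finite_subset[OF extra_subset finite_C])

lemma finite_colorings:
  assumes "extra U M" shows "finite (colorings U M)"
proof -
  have "finite (Pi\<^sub>E U M)"
    using assms extra_finite extra_finite_list by (intro finite_PiE) auto
  then show ?thesis unfolding colorings_def by (rule rev_finite_subset) auto
qed

lemma colorings_memD: "\<sigma> \<in> colorings U M \<Longrightarrow> u \<in> U \<Longrightarrow> \<sigma> u \<in> M u"
  by (auto simp: colorings_def)

lemma colorings_iff:
  "\<sigma> \<in> colorings U M \<longleftrightarrow> (\<forall>u. u \<notin> U \<longrightarrow> \<sigma> u = undefined) \<and> (\<forall>u\<in>U. \<sigma> u \<in> M u) \<and>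
     (\<forall>u\<in>U. \<forall>w\<in>U. w \<in> N u \<longrightarrow> \<sigma> u \<noteq> \<sigma> w)"
  by (auto simp: colorings_def PiE_def extensional_def)

text \<open>Forgetting \<open>v\<close> is undone by restoring its colour \<open>c\<close>. This
  identifies conditioning on the colour of \<open>v\<close> with a smaller instance, which drives
  all recursions below.\<close>

lemma bij_betw_pin:
  assumes "v \<in> U" "c \<in> M v"
  shows "bij_betw (\<lambda>\<sigma>. restrict \<sigma> (U - {v})) {\<sigma> \<in> colorings U M. \<sigma> v = c}
           (colorings (U - {v}) (pin M v c))"
proof (rule bij_betw_byWitness[where f' = "\<lambda>\<rho>. \<rho>(v := c)"])
  show "\<forall>\<sigma>\<in>{\<sigma> \<in> colorings U M. \<sigma> v = c}. (restrict \<sigma> (U - {v}))(v := c) = \<sigma>"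
    by (simp add: colorings_iff fun_eq_iff restrict_def)
  show "\<forall>\<rho>\<in>colorings (U - {v}) (pin M v c). restrict (\<rho>(v := c)) (U - {v}) = \<rho>"
    by (simp add: colorings_iff fun_eq_iff restrict_def)
  show "(\<lambda>\<sigma>. restrict \<sigma> (U - {v})) ` {\<sigma> \<in> colorings U M. \<sigma> v = c} \<subseteq> colorings (U - {v}) (pin M v c)"
  proof (rule image_subsetI)
    fix \<sigma> assume "\<sigma> \<in> {\<sigma> \<in> colorings U M. \<sigma> v = c}"
    then have \<sigma>: "\<forall>u\<in>U. \<sigma> u \<in> M u" "\<forall>u\<in>U. \<forall>w\<in>U. w \<in> N u \<longrightarrow> \<sigma> u \<noteq> \<sigma> w" "\<sigma> v = c"
      by (simp_all add: colorings_iff)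
    have "\<sigma> w \<noteq> c" if "w \<in> U" "w \<in> N v" for w
      using \<sigma>(2,3) assms(1) that by metis
    then show "restrict \<sigma> (U - {v}) \<in> colorings (U - {v}) (pin M v c)"
      using \<sigma>(1,2) by (simp add: colorings_iff pin_def)
  qed
  show "(\<lambda>\<rho>. \<rho>(v := c)) ` colorings (U - {v}) (pin M v c) \<subseteq> {\<sigma> \<in> colorings U M. \<sigma> v = c}"
  proof (rule image_subsetI)
    fix \<rho> assume \<rho>: "\<rho> \<in> colorings (U - {v}) (pin M v c)"
    have 1: "\<rho> u \<in> pin M v c u" if "u \<in> U" "u \<noteq> v" for u
      using \<rho> that by (simp add: colorings_iff)
    have 2: "\<rho> u \<in> M u" if "u \<in> U" "u \<noteq> v" for u
      using 1[OF that] by (simp add: pin_def split: if_splits)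
    have 3: "\<rho> u \<noteq> c" if "u \<in> U" "u \<in> N v" for u
      using 1[of u] that N_irrefl by (auto simp: pin_def)
    have 4: "\<rho> u \<noteq> c" if "u \<in> U" "v \<in> N u" for u
      using 3[of u] that N_sym by simp
    have 5: "\<rho> u \<noteq> \<rho> w" if "u \<in> U" "u \<noteq> v" "w \<in> U" "w \<noteq> v" "w \<in> N u" for u w
      using \<rho> that by (simp add: colorings_iff)
    have "\<rho> u = undefined" if "u \<notin> U" for u
      using \<rho> that by (simp add: colorings_iff)
    then show "\<rho>(v := c) \<in> {\<sigma> \<in> colorings U M. \<sigma> v = c}"
      using assms 2 3 4 5 N_irrefl by (auto simp: colorings_iff)
  qed
qed

lemma card_pin:
  assumes "v \<in> U" "c \<in> M v"
  shows "card {\<sigma> \<in> colorings U M. \<sigma> v = c} = card (colorings (U - {v}) (pin M v c))"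
  using bij_betw_pin[of v U c M, OF assms] by (rule bij_betw_same_card)

lemma card_pin2:
  assumes "v \<in> U" "c \<in> M v" "u \<in> U" "u \<noteq> v"
  shows "card {\<sigma> \<in> colorings U M. \<sigma> v = c \<and> \<sigma> u = b}
       = card {\<rho> \<in> colorings (U - {v}) (pin M v c). \<rho> u = b}"
proof (rule bij_betw_same_card[where f = "\<lambda>\<sigma>. restrict \<sigma> (U - {v})"])
  note B = bij_betw_pin[of v U c M, OF assms(1,2)]
  have "{\<rho> \<in> colorings (U - {v}) (pin M v c). \<rho> u = b}
     = (\<lambda>\<sigma>. restrict \<sigma> (U - {v})) ` {\<sigma> \<in> colorings U M. \<sigma> v = c \<and> \<sigma> u = b}"
    unfolding bij_betw_imp_surj_on[OF B, symmetric] using assms(3,4) by auto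
  then show "bij_betw (\<lambda>\<sigma>. restrict \<sigma> (U - {v})) {\<sigma> \<in> colorings U M. \<sigma> v = c \<and> \<sigma> u = b}
      {\<rho> \<in> colorings (U - {v}) (pin M v c). \<rho> u = b}"
    using B by (auto simp: bij_betw_def intro: inj_on_subset)
qed

text \<open>Pinning read as availability: the colourings that survive are those that leave
  \<open>c\<close> usable at \<open>v\<close>.\<close>

lemma colorings_pin:
  "colorings U (pin M v c) = {\<rho> \<in> colorings U M. c \<notin> \<rho> ` (N v \<inter> U)}"
proof (rule Set.set_eqI)
  fix \<rho>
  show "\<rho> \<in> colorings U (pin M v c) \<longleftrightarrow> \<rho> \<in> {\<rho> \<in> colorings U M. c \<notin> \<rho> ` (N v \<inter> U)}"
    by (auto simp: colorings_iff pin_def split: if_splits)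
qed

lemma card_colorings_split:
  assumes "extra U M" "v \<in> U"
  shows "card (colorings U M) = (\<Sum>c\<in>M v. card (colorings (U - {v}) (pin M v c)))"
proof -
  have "colorings U M = (\<Union>c\<in>M v. {\<sigma> \<in> colorings U M. \<sigma> v = c})"
    using assms colorings_memD by blast
  then have "card (colorings U M) = card (\<Union>c\<in>M v. {\<sigma> \<in> colorings U M. \<sigma> v = c})" by simp
  also have "\<dots> = (\<Sum>c\<in>M v. card {\<sigma> \<in> colorings U M. \<sigma> v = c})"
    using assms finite_colorings extra_finite_list by (intro card_UN_disjoint) auto
  finally show ?thesis using assms card_pin by simp
qed

section \<open>Surplus colours: stability under pinning and lower bounds on counts\<close>

lemma extra_remove:
  assumes "extra U M" "v \<in> U"
  shows "extra (U - {v}) M"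
proof -
  have "card (N w \<inter> (U - {v})) \<le> card (N w \<inter> U)" for w
    using assms by (intro card_mono) (auto simp: extra_finite)
  then show ?thesis using assms unfolding extra_def
    by (smt (verit, ccfv_threshold) Diff_iff finite_Diff of_nat_mono)
qed

text \<open>A neighbour of \<open>v\<close> loses at most one colour and exactly one neighbour in
  \<open>U\<close>, so the surplus is kept. The lists \<open>M'\<close> are left general to cover
  the hybrids in \<open>influence_le\<close>, where different neighbours of \<open>v\<close> lose
  different colours or none.\<close>

lemma extra_pin:
  assumes "extra U M" "v \<in> U"
    and M': "\<And>w. w \<in> U - {v} \<Longrightarrow> M' w \<subseteq> M w"
      "\<And>w. w \<in> U - {v} \<Longrightarrow> w \<in> N v \<Longrightarrow> card (M w) \<le> Suc (card (M' w))"
      "\<And>w. w \<in> U - {v} \<Longrightarrow> w \<notin> N v \<Longrightarrow> M' w = M w"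
  shows "extra (U - {v}) M'"
  unfolding extra_def
proof (intro conjI ballI)
  show "finite (U - {v})" using assms extra_finite by auto
  fix w assume w: "w \<in> U - {v}"
  show "M' w \<subseteq> C" using M'(1)[OF w] extra_subset[OF assms(1)] w by blast
  have ext: "\<beta> + real (card (N w \<inter> U)) \<le> real (card (M w))"
    using assms(1) w by (auto simp: extra_def)
  have fin: "finite (N w \<inter> U)" using assms extra_finite by auto
  show "\<beta> + real (card (N w \<inter> (U - {v}))) \<le> real (card (M' w))"
  proof (cases "w \<in> N v")
    case True
    then have "N w \<inter> U = insert v (N w \<inter> (U - {v}))" using N_sym assms(2) by auto
    then have "card (N w \<inter> U) = Suc (card (N w \<inter> (U - {v})))"
      using fin by (metis Diff_iff IntD2 card_insert_disjoint finite_insert insertI1)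
    then show ?thesis using ext M'(2)[OF w True] by linarith
  next
    case False
    then have "N w \<inter> (U - {v}) = N w \<inter> U" using N_sym by auto
    then show ?thesis using ext M'(3)[OF w False] by simp
  qed
qed

lemma card_le_Suc_card_Diff: "card A \<le> Suc (card (A - {c}))"
  by (cases "finite A") (auto simp: card_Diff_singleton_if)

lemma extra_pin':
  assumes "extra U M" "v \<in> U"
  shows "extra (U - {v}) (pin M v c)"
  using assms by (rule extra_pin) (auto simp: pin_def card_le_Suc_card_Diff)

text \<open>A colouring of \<open>U - {v}\<close> blocks at most one colour per neighbour of
  \<open>v\<close>, hence extends to \<open>v\<close> in at least \<open>\<beta>\<close>
  ways.\<close>

lemma card_colorings_remove:
  assumes "extra U M" "v \<in> U"
  shows "\<beta> * card (colorings (U - {v}) M) \<le> card (colorings U M)"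
proof -
  let ?R = "colorings (U - {v}) M"
  have finR: "finite ?R" using extra_remove[OF assms] finite_colorings by blast
  have fM: "finite (M v)" using assms extra_finite_list by blast
  have fU: "finite U" using assms extra_finite by blast
  have NU: "N v \<inter> (U - {v}) = N v \<inter> U" using N_irrefl by auto
  have "\<beta> * card ?R = (\<Sum>\<rho>\<in>?R. \<beta>)" by simp
  also have "\<dots> \<le> (\<Sum>\<rho>\<in>?R. real (card {c\<in>M v. c \<notin> \<rho> ` (N v \<inter> U)}))"
  proof (rule sum_mono)
    fix \<rho>
    have "{c\<in>M v. c \<notin> \<rho> ` (N v \<inter> U)} = M v - \<rho> ` (N v \<inter> U)" by auto
    then have "card (M v) - card (\<rho> ` (N v \<inter> U)) \<le> card {c\<in>M v. c \<notin> \<rho> ` (N v \<inter> U)}"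
      using fU by (simp add: diff_card_le_card_Diff)
    moreover have "card (\<rho> ` (N v \<inter> U)) \<le> card (N v \<inter> U)" using fU by (simp add: card_image_le)
    moreover have "\<beta> + real (card (N v \<inter> U)) \<le> real (card (M v))"
      using assms by (auto simp: extra_def)
    ultimately show "\<beta> \<le> real (card {c\<in>M v. c \<notin> \<rho> ` (N v \<inter> U)})" by linarith
  qed
  \<comment> \<open>Pairs of a colouring and an available colour are now counted colour by colour,
    which gives the summands of \<open>card_colorings_split\<close>.\<close>
  also have "\<dots> = real (\<Sum>\<rho>\<in>?R. \<Sum>c\<in>M v. if c \<notin> \<rho> ` (N v \<inter> U) then 1 else 0)"
    using fM by (simp add: sum.If_cases Int_def conj_commute del: image_Int)
  also have "\<dots> = real (\<Sum>c\<in>M v. \<Sum>\<rho>\<in>?R. if c \<notin> \<rho> ` (N v \<inter> U) then 1 else 0)"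
    by (subst sum.swap) simp
  also have "\<dots> = real (\<Sum>c\<in>M v. card {\<rho>\<in>?R. c \<notin> \<rho> ` (N v \<inter> U)})"
    using finR by (simp add: sum.If_cases Int_def conj_commute del: image_Int)
  also have "\<dots> = card (colorings U M)"
    using card_colorings_split[OF assms] by (simp add: colorings_pin NU)
  finally show ?thesis .
qed

text \<open>Greedy colouring, one vertex at a time. It makes all denominators of \<open>prob\<close>
  positive.\<close>

lemma card_colorings_pos:
  assumes "extra U M"
  shows "0 < card (colorings U M)"
proof -
  have "finite U" using assms extra_finite by blast
  then show ?thesis using assms
  proof (induction U rule: finite_induct)
    case empty
    then show ?case by (auto simp: colorings_def)
  next
    case (insert v U)
    have "extra U M" using extra_remove[OF insert.prems, of v] insert.hyps by simp
    then have "0 < card (colorings U M)" using insert.IH by blast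
    moreover have "\<beta> * card (colorings U M) \<le> card (colorings (insert v U) M)"
      using card_colorings_remove[OF insert.prems, of v] insert.hyps by simp
    moreover have "0 < \<beta> * card (colorings U M)" using calculation(1) \<beta>_pos by simp
    ultimately show ?case by linarith
  qed
qed

section \<open>Marginals of a uniformly random list colouring\<close>

lemma prob_outside:
  assumes "u \<in> U" "b \<notin> M u"
  shows "prob U M u b = 0"
proof -
  have "{\<sigma> \<in> colorings U M. \<sigma> u = b} = {}" using assms colorings_memD by blast
  then show ?thesis by (simp only: prob_def) simp
qed

lemma prob_nonneg: "0 \<le> prob U M u b"
  by (simp add: prob_def)

lemma prob_eq:
  assumes "u \<in> U" "b \<in> M u"
  shows "prob U M u b = card (colorings (U - {u}) (pin M u b)) / card (colorings U M)"
  using card_pin[of u U b M, OF assms] by (simp add: prob_def)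

text \<open>Fixing \<open>u\<close> to \<open>b\<close> only restricts the colourings of the other
  vertices, while leaving \<open>u\<close> open multiplies their number by at least
  \<open>\<beta>\<close>.\<close>

lemma prob_le:
  assumes "extra U M" "u \<in> U"
  shows "prob U M u b \<le> 1 / \<beta>"
proof (cases "b \<in> M u")
  case True
  have "card (colorings (U - {u}) (pin M u b)) \<le> card (colorings (U - {u}) M)"
    using extra_remove[OF assms] finite_colorings by (intro card_mono) (auto simp: colorings_pin)
  then have "\<beta> * card (colorings (U - {u}) (pin M u b)) \<le> \<beta> * card (colorings (U - {u}) M)"
    using \<beta>_pos by simp
  also have "\<dots> \<le> card (colorings U M)" using card_colorings_remove[OF assms] .
  finally show ?thesis
    using \<beta>_pos card_colorings_pos[OF assms(1)] by (simp add: prob_eq[of u U b M, OF assms(2) True] field_simps)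
next
  case False
  then show ?thesis using prob_outside[OF assms(2)] \<beta>_pos by simp
qed

lemma sum_prob:
  assumes "extra U M" "u \<in> U" "M u \<subseteq> B" "finite B"
  shows "(\<Sum>b\<in>B. prob U M u b) = 1"
proof -
  have "(\<Sum>b\<in>B. prob U M u b) = (\<Sum>b\<in>M u. prob U M u b)"
    using assms prob_outside by (intro sum.mono_neutral_right) auto
  also have "\<dots> = (\<Sum>b\<in>M u. card (colorings (U - {u}) (pin M u b))) / card (colorings U M)"
    using assms(2) by (simp add: prob_eq sum_divide_distrib)
  also have "\<dots> = 1"
    using card_colorings_split[OF assms(1,2)] card_colorings_pos[OF assms(1)]
    by (metis divide_self less_irrefl of_nat_0_less_iff of_nat_sum)
  finally show ?thesis .
qed

text \<open>The law of total probability over the colour of \<open>w\<close>. Summing over a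
  superset \<open>B\<close> of the list lets two list assignments be expanded over the same
  colours.\<close>

lemma total_prob:
  assumes "extra U M" "w \<in> U" "u \<in> U" "u \<noteq> w" "M w \<subseteq> B" "finite B"
  shows "prob U M u a = (\<Sum>b\<in>B. prob U M w b * prob (U - {w}) (pin M w b) u a)"
proof -
  have fM: "finite (M w)" using assms extra_finite_list by blast
  have "{\<sigma> \<in> colorings U M. \<sigma> u = a} = (\<Union>b\<in>M w. {\<sigma> \<in> colorings U M. \<sigma> w = b \<and> \<sigma> u = a})"
    using assms colorings_memD by blast
  then have "card {\<sigma> \<in> colorings U M. \<sigma> u = a} = card (\<Union>b\<in>M w. {\<sigma> \<in> colorings U M. \<sigma> w = b \<and> \<sigma> u = a})"
    by simp
  also have "\<dots> = (\<Sum>b\<in>M w. card {\<sigma> \<in> colorings U M. \<sigma> w = b \<and> \<sigma> u = a})"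
    using assms finite_colorings fM by (intro card_UN_disjoint) auto
  finally have *: "real (card {\<sigma> \<in> colorings U M. \<sigma> u = a})
      = (\<Sum>b\<in>M w. real (card {\<sigma> \<in> colorings U M. \<sigma> w = b \<and> \<sigma> u = a}))" by simp
  have "prob U M u a = (\<Sum>b\<in>M w. card {\<sigma> \<in> colorings U M. \<sigma> w = b \<and> \<sigma> u = a} / card (colorings U M))"
    by (simp add: prob_def * sum_divide_distrib)
  also have "\<dots> = (\<Sum>b\<in>M w. prob U M w b * prob (U - {w}) (pin M w b) u a)"
  proof (rule sum.cong)
    fix b assume b: "b \<in> M w"
    have "0 < card (colorings (U - {w}) (pin M w b))"
      using extra_pin'[OF assms(1,2)] card_colorings_pos by blast
    then show "card {\<sigma> \<in> colorings U M. \<sigma> w = b \<and> \<sigma> u = a} / card (colorings U M)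
        = prob U M w b * prob (U - {w}) (pin M w b) u a"
      unfolding prob_eq[of w U b M, OF assms(2) b] card_pin2[of w U b M, OF assms(2) b assms(3,4)]
      by (simp add: prob_def)
  qed simp
  also have "\<dots> = (\<Sum>b\<in>B. prob U M w b * prob (U - {w}) (pin M w b) u a)"
    using assms prob_outside by (intro sum.mono_neutral_left) auto
  finally show ?thesis .
qed

section \<open>Distances between marginals and the influence bound\<close>

lemma colorings_cong: "(\<And>u. u \<in> U \<Longrightarrow> M u = M' u) \<Longrightarrow> colorings U M = colorings U M'"
  by (auto simp: colorings_iff)

lemma prob_cong: "(\<And>u. u \<in> U \<Longrightarrow> M u = M' u) \<Longrightarrow> prob U M u b = prob U M' u b"
  using colorings_cong[of U M M'] by (simp add: prob_def)

lemma dist1_cong: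
  "\<lbrakk>\<And>u. u \<in> U \<Longrightarrow> M1 u = M1' u; \<And>u. u \<in> U \<Longrightarrow> M2 u = M2' u\<rbrakk>
    \<Longrightarrow> dist1 U M1 M2 = dist1 U M1' M2'"
  using prob_cong[of U M1 M1'] prob_cong[of U M2 M2'] by (simp add: dist1_def)

lemma dist1_commute: "dist1 U M M' = dist1 U M' M"
  by (simp add: dist1_def abs_minus_commute)

lemma dist1_same [simp]: "dist1 U M M = 0"
  by (simp add: dist1_def)

lemma dist1_triangle: "dist1 U M1 M3 \<le> dist1 U M1 M2 + dist1 U M2 M3"
  unfolding dist1_def sum.distrib[symmetric] by (intro sum_mono) auto

text \<open>Once the colour of \<open>w\<close> is fixed, its list no longer matters, so both
  measures are mixtures of the same conditional laws and differ only in the marginal at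
  \<open>w\<close>. By \<open>le\<close>, only \<open>c'\<close> can be less likely under
  \<open>M1\<close> than under \<open>M2\<close>, and by at most \<open>1 / \<beta>\<close>; this is
  the situation of \<open>sum_abs_signed_mixture_le\<close> with \<open>d = c'\<close>.\<close>

lemma dist1_swap_aux:
  assumes w: "w \<in> U" and M1: "extra U M1" and M2: "extra U M2"
    and M1_eq: "M1 = M(w := M w - {c'})" and M2_eq: "M2 = M(w := M w - {c})"
    and "c \<noteq> c'" "c' \<in> C" and I: "0 \<le> I"
    and IH: "\<And>b b'. b \<in> M w \<Longrightarrow> b' \<in> M w \<Longrightarrow>
          dist1 (U - {w}) (pin M w b) (pin M w b') \<le> I"
    and le: "card (colorings U M1) \<le> card (colorings U M2)"
  shows "dist1 U M1 M2 \<le> 1 / \<beta> * (2 + I)"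
proof -
  let ?\<gamma> = "\<lambda>b. prob U M1 w b - prob U M2 w b"
  let ?F = "\<lambda>b i. prob (U - {w}) (pin M w b) (fst i) (snd i)"
  let ?T = "(U - {w}) \<times> C"
  have fU: "finite U" using M1 extra_finite by blast
  have sub: "M1 w \<subseteq> C" "M2 w \<subseteq> C" using M1 M2 w extra_subset by blast+
  have pin1: "prob (U - {w}) (pin M1 w b) u a = prob (U - {w}) (pin M w b) u a" for b u a
    by (rule prob_cong) (auto simp: pin_def M1_eq)
  have pin2: "prob (U - {w}) (pin M2 w b) u a = prob (U - {w}) (pin M w b) u a" for b u a
    by (rule prob_cong) (auto simp: pin_def M2_eq)
  have pcol1: "colorings (U - {w}) (pin M1 w b) = colorings (U - {w}) (pin M w b)" for b
    by (rule colorings_cong) (auto simp: pin_def M1_eq)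
  have pcol2: "colorings (U - {w}) (pin M2 w b) = colorings (U - {w}) (pin M w b)" for b
    by (rule colorings_cong) (auto simp: pin_def M2_eq)
  have c'1: "prob U M1 w c' = 0" using prob_outside[of w U c' M1] w M1_eq by simp
  have c2: "prob U M2 w c = 0" using prob_outside[of w U c M2] w M2_eq by simp
  have "dist1 U M1 M2 = (\<Sum>b\<in>C. \<bar>?\<gamma> b\<bar>) +
      (\<Sum>u\<in>U - {w}. \<Sum>a\<in>C. \<bar>prob U M1 u a - prob U M2 u a\<bar>)"
    unfolding dist1_def using sum.remove[OF fU w] by blast
  also have "(\<Sum>u\<in>U - {w}. \<Sum>a\<in>C. \<bar>prob U M1 u a - prob U M2 u a\<bar>)
      = (\<Sum>u\<in>U - {w}. \<Sum>a\<in>C. \<bar>\<Sum>b\<in>C. ?\<gamma> b * ?F b (u, a)\<bar>)"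
  proof (intro sum.cong refl arg_cong[where f = abs])
    fix u a assume u: "u \<in> U - {w}"
    show "prob U M1 u a - prob U M2 u a = (\<Sum>b\<in>C. ?\<gamma> b * ?F b (u, a))"
      using u total_prob[OF M1 w, of u C a] total_prob[OF M2 w, of u C a] sub finite_C
      by (simp add: pin1 pin2 left_diff_distrib sum_subtractf)
  qed
  also have "\<dots> = (\<Sum>i\<in>?T. \<bar>\<Sum>b\<in>C. ?\<gamma> b * ?F b i\<bar>)"
    by (simp add: sum.cartesian_product case_prod_unfold)
  also have "(\<Sum>b\<in>C. \<bar>?\<gamma> b\<bar>) + \<dots> \<le> 1 / \<beta> * (2 + I)"
  proof (rule sum_abs_signed_mixture_le[OF finite_C \<open>c' \<in> C\<close>])
    show "(\<Sum>b\<in>C. ?\<gamma> b) = 0"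
      using sum_prob[OF M1 w sub(1) finite_C] sum_prob[OF M2 w sub(2) finite_C]
      by (simp add: sum_subtractf)
    show "- ?\<gamma> c' \<le> 1 / \<beta>" using prob_le[OF M2 w, of c'] c'1 by simp
    show "0 \<le> I" by fact
    fix b
    \<comment> \<open>For a colour of \<open>M w\<close> other than \<open>c\<close> and
      \<open>c'\<close> both marginals have the same numerator, and \<open>M1\<close> has the
      smaller denominator. The colour \<open>c\<close> is impossible under
      \<open>M2\<close>.\<close>
    show "0 \<le> ?\<gamma> b" if "b \<noteq> c'"
    proof (cases "b = c \<or> b \<notin> M w")
      case True
      then have "prob U M2 w b = 0" using c2 prob_outside[of w U b M2] w M2_eq by auto
      then show ?thesis using prob_nonneg by simp
    next
      case False
      have b: "b \<in> M1 w" "b \<in> M2 w" using False that M1_eq M2_eq by auto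
      have "prob U M1 w b = card (colorings (U - {w}) (pin M w b)) / card (colorings U M1)"
        using prob_eq[of w U b M1] w b by (simp add: pcol1)
      moreover have "prob U M2 w b = card (colorings (U - {w}) (pin M w b)) / card (colorings U M2)"
        using prob_eq[of w U b M2] w b by (simp add: pcol2)
      ultimately show ?thesis using le card_colorings_pos[OF M1] card_colorings_pos[OF M2]
        by (simp add: frac_le)
    qed
    assume b: "?\<gamma> b \<noteq> 0" "?\<gamma> c' \<noteq> 0"
    \<comment> \<open>A nonzero difference of marginals places the colour in one of the two lists,
      hence in \<open>M w\<close>, where \<open>IH\<close> applies.\<close>
    have "b \<in> M w"
      using b(1) prob_outside[OF w, of b M1] prob_outside[OF w, of b M2]
      unfolding M1_eq M2_eq by (cases "b \<in> M w") simp_all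
    moreover have "c' \<in> M w"
      using b(2) prob_outside[OF w, of c' M1] prob_outside[OF w, of c' M2]
      unfolding M1_eq M2_eq by (cases "c' \<in> M w") simp_all
    ultimately show "(\<Sum>i\<in>?T. \<bar>?F b i - ?F c' i\<bar>) \<le> I"
      using IH[of b c'] by (simp add: dist1_def sum.cartesian_product case_prod_unfold)
  qed
  finally show ?thesis .
qed

text \<open>The distance is symmetric, so the list assignment with fewer colourings may take the
  role of \<open>M1\<close>.\<close>

lemma dist1_swap:
  assumes w: "w \<in> U" and M1: "extra U (M(w := M w - {c}))" and M2: "extra U (M(w := M w - {c'}))"
    and "c \<in> C" "c' \<in> C" and I: "0 \<le> I"
    and IH: "\<And>b b'. b \<in> M w \<Longrightarrow> b' \<in> M w \<Longrightarrow>
          dist1 (U - {w}) (pin M w b) (pin M w b') \<le> I"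
  shows "dist1 U (M(w := M w - {c})) (M(w := M w - {c'})) \<le> 1 / \<beta> * (2 + I)"
proof (cases "c = c'")
  case True
  then show ?thesis using I \<beta>_pos by simp
next
  case False
  show ?thesis
  proof (cases "card (colorings U (M(w := M w - {c}))) \<le> card (colorings U (M(w := M w - {c'})))")
    case True
    then show ?thesis
      using dist1_swap_aux[OF w M1 M2 refl refl False[symmetric] \<open>c \<in> C\<close> I IH] by blast
  next
    case False2: False
    then have "dist1 U (M(w := M w - {c'})) (M(w := M w - {c})) \<le> 1 / \<beta> * (2 + I)"
      using dist1_swap_aux[OF w M2 M1 refl refl False \<open>c' \<in> C\<close> I IH] by linarith
    then show ?thesis by (simp add: dist1_commute)
  qed
qed

text \<open>Induction on the number of vertices. The two pinnings are joined by a chain of hybrids,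
  each step changing the list of one neighbour of \<open>v\<close>; there are at most
  \<open>D\<close> steps, and \<open>fix_point\<close> closes the recursion.\<close>

lemma influence_le:
  assumes I: "0 \<le> I" and fix_point: "real D * (1 / \<beta> * (2 + I)) \<le> I"
    and "extra U M" "\<And>u. u \<in> U \<Longrightarrow> card (N u \<inter> U) \<le> D"
    and "v \<in> U" "c \<in> M v" "c' \<in> M v"
  shows "dist1 (U - {v}) (pin M v c) (pin M v c') \<le> I"
  using assms(3-)
proof (induction "card U" arbitrary: U M v c c' rule: less_induct)
  case less
  let ?U = "U - {v}"
  let ?J = "N v \<inter> ?U"
  have fU: "finite U" using less.prems extra_finite by blast
  have cC: "c \<in> C" "c' \<in> C" using less.prems extra_subset by blast+
  \<comment> \<open>Neighbours of \<open>v\<close> in \<open>J\<close> lose \<open>c\<close>, the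
    others lose \<open>c'\<close>: all of \<open>?J\<close> gives the pinning to \<open>c\<close>,
    the empty set the pinning to \<open>c'\<close>.\<close>
  define hyb where "hyb J = (\<lambda>w. if w \<in> J then M w - {c} else if w \<in> N v then M w - {c'} else M w)"
    for J
  have hyb_extra: "extra ?U (hyb J)" if "J \<subseteq> ?J" for J
    using that less.prems(1,3)
    by (intro extra_pin[of U M]) (auto simp: hyb_def card_le_Suc_card_Diff)
  have "dist1 ?U (hyb J) (hyb {}) \<le> card J * (1 / \<beta> * (2 + I))" if "finite J" "J \<subseteq> ?J" for J
    using that
  proof (induction J rule: finite_induct)
    case empty
    then show ?case by simp
  next
    case (insert w J)
    then have w: "w \<in> ?U" "w \<in> N v" "J \<subseteq> ?J" by auto
    \<comment> \<open>With the full list restored at \<open>w\<close>, consecutive hybrids both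
      arise from \<open>Mb\<close> by deleting one colour at \<open>w\<close>.\<close>
    define Mb where "Mb = (hyb J)(w := M w)"
    have e1: "hyb (insert w J) = Mb(w := Mb w - {c})"
      by (auto simp: hyb_def Mb_def fun_eq_iff)
    have e2: "hyb J = Mb(w := Mb w - {c'})"
      using insert.hyps w by (auto simp: hyb_def Mb_def fun_eq_iff)
    have Mb: "extra ?U Mb"
      using w less.prems(1,3)
      by (intro extra_pin[of U M]) (auto simp: hyb_def Mb_def card_le_Suc_card_Diff)
    have "dist1 ?U (hyb (insert w J)) (hyb J) \<le> 1 / \<beta> * (2 + I)"
      unfolding e1 e2
    proof (rule dist1_swap[OF w(1) _ _ cC I])
      show "extra ?U (Mb(w := Mb w - {c}))"
        using hyb_extra[OF insert.prems] e1 by simp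
      show "extra ?U (Mb(w := Mb w - {c'}))"
        using hyb_extra[OF w(3)] e2 by simp
      fix b b' assume b: "b \<in> Mb w" "b' \<in> Mb w"
      show "dist1 (?U - {w}) (pin Mb w b) (pin Mb w b') \<le> I"
      \<comment> \<open>The induction hypothesis for the smaller instance \<open>?U\<close>, with
        \<open>w\<close> in the role of \<open>v\<close>.\<close>
      proof (rule less.hyps[OF _ Mb _ w(1) b])
        show "card ?U < card U" using fU less.prems(3) by (meson card_Diff1_less)
        fix u assume "u \<in> ?U"
        then have "card (N u \<inter> U) \<le> D" using less.prems(2) by simp
        moreover have "card (N u \<inter> ?U) \<le> card (N u \<inter> U)" using fU by (intro card_mono) auto
        ultimately show "card (N u \<inter> ?U) \<le> D" by simp
      qed
    qed
    moreover have "dist1 ?U (hyb J) (hyb {}) \<le> card J * (1 / \<beta> * (2 + I))"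
      using insert.IH w by simp
    ultimately show ?case
      using dist1_triangle[of ?U "hyb (insert w J)" "hyb {}" "hyb J"] insert.hyps
      by (simp add: distrib_right add_divide_distrib)
  qed
  from this[of ?J] have "dist1 ?U (hyb ?J) (hyb {}) \<le> card ?J * (1 / \<beta> * (2 + I))"
    using fU by simp
  also have "\<dots> \<le> real D * (1 / \<beta> * (2 + I))"
  proof (rule mult_right_mono)
    have "?J = N v \<inter> U" using N_irrefl by auto
    then show "real (card ?J) \<le> real D" using less.prems(2,3) by simp
    show "0 \<le> 1 / \<beta> * (2 + I)" using \<beta>_pos I by simp
  qed
  also have "\<dots> \<le> I" by fact
  also have "dist1 ?U (hyb ?J) (hyb {}) = dist1 ?U (pin M v c) (pin M v c')"
    by (rule dist1_cong) (auto simp: hyb_def pin_def)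
  finally show ?case .
qed

end

section \<open>The second eigenvalue of a reversible kernel\<close>

text \<open>Linear factors are split off by the fundamental theorem of algebra; all roots being
  real, the factors are real too. It guarantees that the eigenvalue list below has full
  length.\<close>

lemma size_proots_real_rooted:
  fixes p :: "real poly"
  assumes "p \<noteq> 0" and real: "\<And>z. poly (map_poly complex_of_real p) z = 0 \<Longrightarrow> z \<in> \<real>"
  shows "size (proots p) = degree p"
  using assms
proof (induction "degree p" arbitrary: p rule: less_induct)
  case less
  interpret h: map_poly_inj_idom_hom complex_of_real ..
  show ?case
  proof (cases "degree p = 0")
    case True
    then obtain a where "p = [:a:]" by (rule degree_eq_zeroE)
    then show ?thesis by simp
  next
    case False
    then have "\<not> constant (poly (map_poly complex_of_real p))"
      by (simp add: constant_degree)
    then obtain z where z: "poly (map_poly complex_of_real p) z = 0"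
      using fundamental_theorem_of_algebra by blast
    then have "z \<in> \<real>" by (rule less.prems(2))
    then obtain x where x: "z = complex_of_real x" by (rule Reals_cases)
    have "poly p x = 0" using z unfolding x by simp
    then have "[:- x, 1:] dvd p" by (simp add: poly_eq_0_iff_dvd)
    then obtain r where r: "p = [:- x, 1:] * r" by (rule dvdE)
    have r0: "r \<noteq> 0" using r less.prems(1) by (metis mult_zero_right)
    have "degree ([:- x, 1:] * r) = degree [:- x, 1:] + degree r"
      using r0 by (intro degree_mult_eq) simp_all
    then have deg: "degree p = Suc (degree r)" by (simp only: r) simp
    have "size (proots r) = degree r"
    proof (rule less.hyps)
      show "degree r < degree p" using deg by simp
      show "r \<noteq> 0" by fact
      fix w assume "poly (map_poly complex_of_real r) w = 0"
      then have "poly (map_poly complex_of_real p) w = 0"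
        unfolding r by (simp only: h.hom_mult poly_mult) simp
      then show "w \<in> \<real>" by (rule less.prems(2))
    qed
    moreover have "proots p = proots [:- x, 1:] + proots r"
      unfolding r using r0 by (intro proots_mult) simp
    ultimately show ?thesis using deg by simp
  qed
qed

text \<open>Detailed balance makes \<open>A\<close> self-adjoint for the inner product weighted by
  \<open>p\<close>.\<close>

lemma reversible_eigenvalue_real:
  fixes A :: "real mat" and p :: "nat \<Rightarrow> real"
  assumes A: "A \<in> carrier_mat n n" and p: "\<And>i. i < n \<Longrightarrow> 0 < p i"
    and rev: "\<And>i j. i < n \<Longrightarrow> j < n \<Longrightarrow> p i * A $$ (i, j) = p j * A $$ (j, i)"
    and z: "poly (map_poly complex_of_real (char_poly A)) z = 0"
  shows "z \<in> \<real>"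
proof -
  let ?A = "map_mat complex_of_real A"
  have "poly (char_poly ?A) z = 0"
    using z by (simp add: of_real_hom.char_poly_hom[OF A])
  then have "eigenvalue ?A z" using eigenvalue_root_char_poly[of ?A n z] A by simp
  then obtain f where f: "f \<in> carrier_vec n" "f \<noteq> 0\<^sub>v n" "?A *\<^sub>v f = z \<cdot>\<^sub>v f"
    unfolding eigenvalue_def eigenvector_def using A by auto
  have eig: "(\<Sum>j<n. complex_of_real (A $$ (i, j)) * f $ j) = z * f $ i" if "i < n" for i
  proof -
    have "(?A *\<^sub>v f) $ i = (\<Sum>j<n. complex_of_real (A $$ (i, j)) * f $ j)"
      using A f(1) that by (simp add: scalar_prod_def atLeast0LessThan)
    then show ?thesis using f that by simp
  qed
  define S where "S = (\<Sum>i<n. p i * (cmod (f $ i))\<^sup>2)"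
  have "\<exists>i<n. f $ i \<noteq> 0" using f(1,2) by (metis carrier_vecD eq_vecI index_zero_vec)
  then obtain i0 where i0: "i0 < n" "f $ i0 \<noteq> 0" by blast
  have "0 < S" unfolding S_def
    by (rule sum_pos2[of _ i0]) (use i0 p in \<open>auto simp: less_imp_le\<close>)
  \<comment> \<open>The weighted inner product of \<open>f\<close> with its image under
    \<open>A\<close>. It equals \<open>z * S\<close> by the eigenvalue equation and is its own
    conjugate by detailed balance.\<close>
  define Q where "Q = (\<Sum>i<n. \<Sum>j<n. complex_of_real (p i * A $$ (i, j)) * (cnj (f $ i) * f $ j))"
  have norm_sq: "cnj w * w = (complex_of_real (cmod w))\<^sup>2" for w
    using complex_norm_square[of w] by (simp add: mult.commute)
  have "Q = (\<Sum>i<n. complex_of_real (p i) * cnj (f $ i) * (\<Sum>j<n. complex_of_real (A $$ (i, j)) * f $ j))"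
    unfolding Q_def by (simp add: sum_distrib_left mult_ac)
  also have "\<dots> = (\<Sum>i<n. complex_of_real (p i) * cnj (f $ i) * (z * f $ i))"
    using eig by simp
  also have "\<dots> = z * complex_of_real S"
    unfolding S_def of_real_sum sum_distrib_left
    by (rule sum.cong) (simp_all add: norm_sq[symmetric])
  finally have Q1: "Q = z * complex_of_real S" .
  have "cnj Q = (\<Sum>i<n. \<Sum>j<n. complex_of_real (p i * A $$ (i, j)) * (f $ i * cnj (f $ j)))"
    unfolding Q_def by simp
  also have "\<dots> = (\<Sum>j<n. \<Sum>i<n. complex_of_real (p i * A $$ (i, j)) * (f $ i * cnj (f $ j)))"
    by (rule sum.swap)
  also have "\<dots> = Q" unfolding Q_def using rev by (intro sum.cong refl) (simp add: mult.commute)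
  finally have "cnj z * complex_of_real S = z * complex_of_real S" using Q1 by simp
  then have "cnj z = z" using \<open>0 < S\<close> by simp
  then show ?thesis by (simp add: Reals_cnj_iff)
qed

section \<open>Splitting off the eigenvalue 1 of a matrix with row sums 1\<close>

lemma index_mult_mat_sum:
  assumes "A \<in> carrier_mat n n" "B \<in> carrier_mat n n" "i < n" "j < n"
  shows "(A * B) $$ (i, j) = (\<Sum>l<n. A $$ (i, l) * B $$ (l, j))"
  using assms by (simp add: scalar_prod_def atLeast0LessThan)

text \<open>Conjugating by the matrix whose first column is the eigenvector 1 splits off the
  eigenvalue 1; an eigenvector of the transposed remaining block extends to a left eigenvector
  whose entries sum to 0.\<close>

lemma char_poly_row_sums_one:
  fixes A :: "'a :: field mat"
  assumes A: "A \<in> carrier_mat (Suc m) (Suc m)"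
    and row: "\<And>i. i \<le> m \<Longrightarrow> (\<Sum>j\<le>m. A $$ (i, j)) = 1"
  defines "C \<equiv> mat m m (\<lambda>(i, j). A $$ (Suc i, Suc j) - A $$ (0, Suc j))"
  shows "char_poly A = [:- 1, 1:] * char_poly C"
proof -
  let ?n = "Suc m"
  \<comment> \<open>\<open>S\<close> is the identity with its first column replaced by ones, and
    \<open>T\<close> is its inverse.\<close>
  define S where "S = mat ?n ?n (\<lambda>(i, j). if j = 0 \<or> i = j then 1 else 0 :: 'a)"
  define T where "T = mat ?n ?n (\<lambda>(i, j). if i = j then 1 else if j = 0 then - 1 else 0 :: 'a)"
  define R where "R = mat 1 m (\<lambda>(i, j). A $$ (0, Suc j))"
  define F where "F = four_block_mat (1\<^sub>m 1) R (0\<^sub>m m 1) C"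
  have dims [simp]: "S \<in> carrier_mat ?n ?n" "T \<in> carrier_mat ?n ?n" "F \<in> carrier_mat ?n ?n"
    by (auto simp: S_def T_def F_def R_def C_def)
  have ST: "S * T = 1\<^sub>m ?n"
  proof (rule eq_matI)
    fix i j assume ij: "i < dim_row (1\<^sub>m ?n :: 'a mat)" "j < dim_col (1\<^sub>m ?n :: 'a mat)"
    have "(S * T) $$ (i, j) = (\<Sum>l<?n. S $$ (i, l) * T $$ (l, j))"
      using ij by (intro index_mult_mat_sum) auto
    \<comment> \<open>Row \<open>i\<close> of \<open>S\<close> has its ones in columns 0 and
      \<open>i\<close>; the case \<open>i = 0\<close> must not count the same entry twice.\<close>
    also have "\<dots> = (\<Sum>l<?n. (if l = 0 then T $$ (0, j) else 0) + (if l = i then if i \<noteq> 0 then T $$ (i, j) else 0 else 0))"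
      using ij by (intro sum.cong) (auto simp: S_def)
    also have "\<dots> = T $$ (0, j) + (if i \<noteq> 0 then T $$ (i, j) else 0)"
      using ij by (simp add: sum.distrib del: sum.lessThan_Suc)
    also have "\<dots> = (1\<^sub>m ?n) $$ (i, j)" using ij by (auto simp: T_def)
    finally show "(S * T) $$ (i, j) = (1\<^sub>m ?n) $$ (i, j)" .
  qed (auto simp: S_def T_def)
  have TS: "T * S = 1\<^sub>m ?n" using mat_mult_left_right_inverse[OF dims(1,2) ST] .
  have AS: "A * S = S * F"
  proof (rule eq_matI)
    fix i j assume "i < dim_row (S * F)" "j < dim_col (S * F)"
    then have ij: "i < ?n" "j < ?n" by (auto simp: S_def F_def C_def)
    have "(A * S) $$ (i, j) = (\<Sum>l<?n. A $$ (i, l) * S $$ (l, j))"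
      using ij A by (intro index_mult_mat_sum) auto
    also have "\<dots> = (if j = 0 then (\<Sum>l<?n. A $$ (i, l)) else (\<Sum>l<?n. if l = j then A $$ (i, l) else 0))"
      using ij by (cases "j = 0") (auto simp: S_def intro!: sum.cong simp del: sum.lessThan_Suc sum.delta sum.delta')
    also have "\<dots> = (if j = 0 then 1 else A $$ (i, j))"
      using ij row[of i] by (simp add: lessThan_Suc_atMost del: sum.lessThan_Suc)
    finally have 1: "(A * S) $$ (i, j) = (if j = 0 then 1 else A $$ (i, j))" .
    have "(S * F) $$ (i, j) = (\<Sum>l<?n. S $$ (i, l) * F $$ (l, j))"
      using ij by (intro index_mult_mat_sum) auto
    also have "\<dots> = (\<Sum>l<?n. (if l = 0 then F $$ (0, j) else 0) + (if l = i then if i \<noteq> 0 then F $$ (i, j) else 0 else 0))"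
      using ij by (intro sum.cong) (auto simp: S_def)
    also have "\<dots> = F $$ (0, j) + (if i \<noteq> 0 then F $$ (i, j) else 0)"
      using ij by (simp add: sum.distrib del: sum.lessThan_Suc)
    also have "\<dots> = (if j = 0 then 1 else A $$ (i, j))"
      using ij by (cases i; cases j) (auto simp: F_def R_def C_def)
    finally show "(A * S) $$ (i, j) = (S * F) $$ (i, j)" using 1 by simp
  qed (use A in \<open>auto simp: S_def F_def C_def\<close>)
  have "similar_mat A F"
  proof (rule similar_matI[of A F S T ?n])
    have "S * F * T = A * S * T" using AS by simp
    also have "\<dots> = A" using A ST by (simp add: assoc_mult_mat[of A ?n ?n S ?n T ?n])
    finally show "A = S * F * T" by simp
  qed (use A ST TS in auto)
  then have "char_poly A = char_poly F" by (rule char_poly_similar)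
  also have "\<dots> = char_poly (1\<^sub>m 1) * char_poly C"
    unfolding F_def by (rule char_poly_four_block_zeros_col) (auto simp: R_def C_def)
  also have "char_poly (1\<^sub>m 1 :: 'a mat) = [:- 1, 1:]"
    by (simp add: char_poly_defs det_def sign_def)
  finally show ?thesis .
qed

lemma left_eigenvector_of_deflation:
  fixes A :: "'a :: field mat"
  assumes A: "A \<in> carrier_mat (Suc m) (Suc m)"
    and row: "\<And>i. i \<le> m \<Longrightarrow> (\<Sum>j\<le>m. A $$ (i, j)) = 1"
    and root: "poly (char_poly (mat m m (\<lambda>(i, j). A $$ (Suc i, Suc j) - A $$ (0, Suc j)))) \<mu> = 0"
  obtains h where "\<exists>i\<le>m. h i \<noteq> 0" "(\<Sum>i\<le>m. h i) = 0"
    "\<And>j. j \<le> m \<Longrightarrow> (\<Sum>i\<le>m. h i * A $$ (i, j)) = \<mu> * h j"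
proof -
  define C where "C = mat m m (\<lambda>(i, j). A $$ (Suc i, Suc j) - A $$ (0, Suc j))"
  have C: "C \<in> carrier_mat m m" by (simp add: C_def)
  have "poly (char_poly (transpose_mat C)) \<mu> = 0" 
    using root unfolding C_def[symmetric] char_poly_transpose_mat[OF C] .
  then have "eigenvalue (transpose_mat C) \<mu>"
    using eigenvalue_root_char_poly[of "transpose_mat C" m \<mu>] C by simp
  then obtain g where g: "g \<in> carrier_vec m" "g \<noteq> 0\<^sub>v m" "transpose_mat C *\<^sub>v g = \<mu> \<cdot>\<^sub>v g"
    unfolding eigenvalue_def eigenvector_def using C by auto
  have eig: "(\<Sum>i<m. g $ i * (A $$ (Suc i, Suc j) - A $$ (0, Suc j))) = \<mu> * g $ j" if "j < m" for j
  proof -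
    have "(transpose_mat C *\<^sub>v g) $ j = (\<Sum>i<m. g $ i * (A $$ (Suc i, Suc j) - A $$ (0, Suc j)))"
      using g(1) that by (simp add: C_def scalar_prod_def atLeast0LessThan mult.commute)
    then show ?thesis using g that by simp
  qed
  \<comment> \<open>The entry at 0 is chosen to make the total 0; the equations for the other
    columns are then those of the deflated block.\<close>
  define h where "h i = (case i of 0 \<Rightarrow> - (\<Sum>i<m. g $ i) | Suc i \<Rightarrow> g $ i)" for i
  have split: "(\<Sum>i\<le>m. F i) = F 0 + (\<Sum>i<m. F (Suc i))" for F :: "nat \<Rightarrow> 'a"
    by (simp add: sum.atMost_shift)
  have sum0: "(\<Sum>i\<le>m. h i) = 0" by (simp add: split h_def)
  have eq: "(\<Sum>i\<le>m. h i * A $$ (i, Suc j)) = \<mu> * h (Suc j)" if "j < m" for j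
    using eig[OF that]
    by (simp add: split h_def right_diff_distrib sum_subtractf sum_distrib_right)
  show thesis
  proof (rule that[of h])
    have "\<exists>i<m. g $ i \<noteq> 0" using g(1,2) by (metis carrier_vecD eq_vecI index_zero_vec)
    then obtain i where "i < m" "g $ i \<noteq> 0" by blast
    then show "\<exists>i\<le>m. h i \<noteq> 0" by (intro exI[of _ "Suc i"]) (simp add: h_def)
    show "(\<Sum>i\<le>m. h i) = 0" by (rule sum0)
    fix j assume "j \<le> m"
    show "(\<Sum>i\<le>m. h i * A $$ (i, j)) = \<mu> * h j"
    proof (cases j)
      case (Suc j')
      then show ?thesis using eq[of j'] \<open>j \<le> m\<close> by simp
    next
      case 0
      \<comment> \<open>Row sums 1 preserve the total mass 0, so the equation for column 0 follows
        from those for all other columns.\<close>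
      have "(\<Sum>j\<le>m. \<Sum>i\<le>m. h i * A $$ (i, j)) = (\<Sum>i\<le>m. \<Sum>j\<le>m. h i * A $$ (i, j))"
        by (rule sum.swap)
      also have "\<dots> = (\<Sum>i\<le>m. h i * (\<Sum>j\<le>m. A $$ (i, j)))" by (simp add: sum_distrib_left)
      also have "\<dots> = 0" using row sum0 by simp
      finally have "(\<Sum>i\<le>m. h i * A $$ (i, 0)) + (\<Sum>j<m. \<mu> * h (Suc j)) = 0"
        using eq by (simp add: split[of "\<lambda>j. \<Sum>i\<le>m. h i * A $$ (i, j)"])
      moreover have "(\<Sum>j<m. \<mu> * h (Suc j)) = - \<mu> * h 0"
        using sum0 unfolding split[of h] sum_distrib_left[symmetric]
        by (metis add.inverse_inverse add_eq_0_iff minus_mult_commute)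
      ultimately show ?thesis using 0 by simp
    qed
  qed
qed

text \<open>At most one of the first two entries is the added copy of \<open>a\<close>. The other
  belongs to \<open>R\<close>, and the second entry is no larger than it.\<close>

lemma second_of_sorted_desc_le:
  fixes R :: "'a :: linorder multiset"
  assumes "1 \<le> size R" and "\<And>x. x \<in># R \<Longrightarrow> x \<le> B"
  shows "rev (sorted_list_of_multiset (add_mset a R)) ! 1 \<le> B"
proof (rule ccontr)
  define xs where "xs = rev (sorted_list_of_multiset (add_mset a R))"
  assume "\<not> rev (sorted_list_of_multiset (add_mset a R)) ! 1 \<le> B"
  then have gt1: "B < xs ! 1" by (simp add: xs_def)
  have mset: "mset xs = add_mset a R" by (simp add: xs_def)
  then have len: "2 \<le> length xs" using assms(1) by (metis One_nat_def Suc_1 Suc_le_mono size_add_mset size_mset)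
  then obtain x y ys where xs: "xs = x # y # ys"
    by (metis One_nat_def Suc_1 Suc_le_length_iff)
  have "sorted (rev xs)"
    by (simp only: xs_def rev_rev_ident sorted_sorted_list_of_multiset)
  then have "y \<le> x" unfolding xs by (simp add: sorted_append)
  have "x \<in># R \<or> y \<in># R"
  proof (cases "x = a")
    case True
    then have "R = mset (y # ys)" using mset xs by simp
    then show ?thesis by simp
  next
    case False
    then show ?thesis using mset xs by (metis insert_iff list.set_intros(1) set_mset_add_mset_insert set_mset_mset)
  qed
  then show False using assms(2) gt1 \<open>y \<le> x\<close> xs by fastforce
qed

text \<open>After removal of one root 1, every remaining root of the characteristic polynomial has a
  left eigenvector of total mass 0, to which \<open>bound\<close> applies.\<close>

lemma lambda2_le:
  assumes S: "finite S" "2 \<le> card S"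
    and row: "\<And>x. x \<in> S \<Longrightarrow> (\<Sum>y\<in>S. P x y) = 1"
    and p: "\<And>x. x \<in> S \<Longrightarrow> 0 < p x"
    and rev: "\<And>x y. x \<in> S \<Longrightarrow> y \<in> S \<Longrightarrow> p x * P x y = p y * P y x"
    and bound: "\<And>\<mu> h. \<lbrakk>\<exists>x\<in>S. h x \<noteq> 0; (\<Sum>x\<in>S. h x) = 0;
        \<And>y. y \<in> S \<Longrightarrow> (\<Sum>x\<in>S. h x * P x y) = \<mu> * h y\<rbrakk> \<Longrightarrow> \<mu> \<le> B"
  shows "lambda2 S P \<le> B"
proof -
  define xs where "xs = enumeration S"
  have "\<exists>xs. distinct xs \<and> set xs = S" using finite_distinct_list[OF S(1)] by blast
  then have "distinct xs \<and> set xs = S"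
    unfolding xs_def enumeration_def by (rule someI_ex)
  then have xs: "distinct xs" "set xs = S" by auto
  have len: "length xs = card S" using distinct_card[OF xs(1)] xs(2) by simp
  obtain m where m: "card S = Suc m" "1 \<le> m" using S(2) by (cases "card S") auto
  have bij: "bij_betw (nth xs) {..m} S"
    by (rule bij_betw_nth[OF xs(1)]) (simp_all only: len m(1) xs(2) lessThan_Suc_atMost)
  have mem: "xs ! i \<in> S" if "i \<le> m" for i using bij that by (auto simp: bij_betw_def)
  define A where "A = kernel_matrix S P"
  have A: "A \<in> carrier_mat (Suc m) (Suc m)" by (simp add: A_def kernel_matrix_def m)
  have A_nth: "A $$ (i, j) = P (xs ! i) (xs ! j)" if "i \<le> m" "j \<le> m" for i j
    using that by (simp add: A_def kernel_matrix_def m xs_def)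
  have sum_S: "(\<Sum>j\<le>m. F (xs ! j)) = (\<Sum>y\<in>S. F y)" for F :: "'a \<Rightarrow> real"
    using sum.reindex_bij_betw[OF bij] .
  have rowA: "(\<Sum>j\<le>m. A $$ (i, j)) = 1" if "i \<le> m" for i
    using that row[OF mem[OF that]] sum_S[of "P (xs ! i)"] by (simp add: A_nth)
  define C where "C = mat m m (\<lambda>(i, j). A $$ (Suc i, Suc j) - A $$ (0, Suc j))"
  have cp: "char_poly A = [:- 1, 1:] * char_poly C"
    unfolding C_def using char_poly_row_sums_one[OF A rowA] .
  have C: "C \<in> carrier_mat m m" by (simp add: C_def)
  have degC: "degree (char_poly C) = m" "char_poly C \<noteq> 0"
    using degree_monic_char_poly[OF C] by auto
  have degA: "degree (char_poly A) = Suc m" "char_poly A \<noteq> 0"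
    using degree_monic_char_poly[OF A] by auto
  have pr: "proots (char_poly A) = add_mset 1 (proots (char_poly C))"
    unfolding cp using degC(2) by (subst proots_mult) auto
  have "size (proots (char_poly A)) = degree (char_poly A)"
  proof (rule size_proots_real_rooted[OF degA(2)])
    fix z assume "poly (map_poly complex_of_real (char_poly A)) z = 0"
    then show "z \<in> \<real>"
    proof (rule reversible_eigenvalue_real[OF A, where p = "\<lambda>i. p (xs ! i)", rotated 2])
      fix i assume i: "i < Suc m"
      then show "0 < p (xs ! i)" using p mem by simp
      fix j assume "j < Suc m"
      then show "p (xs ! i) * A $$ (i, j) = p (xs ! j) * A $$ (j, i)"
        using i rev[OF mem mem, of i j] by (simp add: A_nth)
    qed
  qed
  \<comment> \<open>Reversibility makes all \<open>Suc m\<close> roots real, so index 1 of the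
    eigenvalue list is in range.\<close>
  then have "1 \<le> size (proots (char_poly C))" using pr degA(1) m(2) by simp
  moreover have "\<mu> \<le> B" if "\<mu> \<in># proots (char_poly C)" for \<mu>
  proof -
    have root: "poly (char_poly C) \<mu> = 0" using that degC(2) by simp
    show "\<mu> \<le> B"
    proof (rule left_eigenvector_of_deflation[OF A rowA root[unfolded C_def]])
      fix h
      assume h: "\<exists>i\<le>m. h i \<noteq> 0" "(\<Sum>i\<le>m. h i) = 0"
        "\<And>j. j \<le> m \<Longrightarrow> (\<Sum>i\<le>m. h i * A $$ (i, j)) = \<mu> * h j"
      define f where "f x = h (the_inv_into {..m} (nth xs) x)" for x
      have f: "f (xs ! i) = h i" if "i \<le> m" for i
        using bij that by (simp add: f_def bij_betw_def the_inv_into_f_f)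
      show "\<mu> \<le> B"
      proof (rule bound[of f])
        obtain i where "i \<le> m" "h i \<noteq> 0" using h(1) by blast
        then show "\<exists>x\<in>S. f x \<noteq> 0" by (intro bexI[of _ "xs ! i"]) (simp_all add: f mem)
        show "(\<Sum>x\<in>S. f x) = 0" using h(2) by (simp add: f flip: sum_S)
        fix y assume "y \<in> S"
        then obtain j where j: "j \<le> m" "y = xs ! j"
          using bij unfolding bij_betw_def by blast
        then show "(\<Sum>x\<in>S. f x * P x y) = \<mu> * f y"
          using h(3)[of j] by (simp add: f A_nth flip: sum_S)
      qed
    qed
  qed
  ultimately show ?thesis
    unfolding lambda2_def eigenvalue_list_def A_def[symmetric] pr
    by (rule second_of_sorted_desc_le)
qed

section \<open>Walks on vertex-colour pairs\<close>

text \<open>If the mass of a left eigenvector \<open>h\<close> with total mass 0 in the block of \<open>u\<close> is \<open>H u\<close>, then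
  summing the eigenvalue equation over that block gives \<open>\<mu> H u = - H u / (card U - 1)\<close>.\<close>

lemma lambda2_block_walk_le:
  fixes J :: "'v \<Rightarrow> nat \<Rightarrow> 'v \<Rightarrow> nat \<Rightarrow> real" and M :: "'v \<Rightarrow> nat set"
  assumes U: "finite U" "2 \<le> card U"
    and M: "\<And>v. v \<in> U \<Longrightarrow> finite (M v)" "\<And>v. v \<in> U \<Longrightarrow> M v \<noteq> {}"
    and P: "\<And>v c u b. \<lbrakk>v \<in> U; c \<in> M v; u \<in> U; b \<in> M u\<rbrakk> \<Longrightarrow>
          P (v, c) (u, b) = (if v = u then 0 else J v c u b / (real (card U) - 1))"
    and J_sum: "\<And>v c u. \<lbrakk>v \<in> U; c \<in> M v; u \<in> U; u \<noteq> v\<rbrakk> \<Longrightarrow> (\<Sum>b\<in>M u. J v c u b) = 1"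
    and p: "\<And>v c. v \<in> U \<Longrightarrow> c \<in> M v \<Longrightarrow> 0 < p v c"
    and rev: "\<And>v c u b. \<lbrakk>v \<in> U; c \<in> M v; u \<in> U; b \<in> M u; u \<noteq> v\<rbrakk> \<Longrightarrow>
          p v c * J v c u b = p u b * J u b v c"
    and influence: "\<And>v c c'. \<lbrakk>v \<in> U; c \<in> M v; c' \<in> M v\<rbrakk> \<Longrightarrow>
          (\<Sum>u\<in>U - {v}. \<Sum>b\<in>M u. \<bar>J v c u b - J v c' u b\<bar>) \<le> I"
    and I: "0 \<le> I"
  shows "lambda2 (Sigma U M) P \<le> I / (real (card U) - 1)"
proof -
  define n where "n = real (card U) - 1"
  note P = P[folded n_def]
  have n: "0 < n" using U(2) by (simp add: n_def)
  have sum_S: "(\<Sum>x\<in>Sigma U M. F x) = (\<Sum>v\<in>U. \<Sum>c\<in>M v. F (v, c))" for F :: "_ \<Rightarrow> real"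
    using sum.Sigma[of U M "\<lambda>v c. F (v, c)"] U(1) M(1) by (simp add: case_prod_unfold)
  have sum_others: "(\<Sum>v\<in>U. if v = u then 0 else F v) = (\<Sum>v\<in>U - {u}. F v)" for u and F :: "_ \<Rightarrow> real"
    using U(1) by (intro sum.mono_neutral_cong_right) auto
  have step: "(\<Sum>x\<in>Sigma U M. h x * P x (u, b))
      = (\<Sum>v\<in>U - {u}. \<Sum>c\<in>M v. h (v, c) * J v c u b) / n" if "u \<in> U" "b \<in> M u" for h u b
  proof -
    have "(\<Sum>x\<in>Sigma U M. h x * P x (u, b))
        = (\<Sum>v\<in>U. if v = u then 0 else (\<Sum>c\<in>M v. h (v, c) * J v c u b) / n)"
      unfolding sum_S using that
      by (intro sum.cong refl) (auto simp: P sum_divide_distrib)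
    then show ?thesis unfolding sum_others by (simp add: sum_divide_distrib)
  qed
  show ?thesis unfolding n_def[symmetric]
  proof (rule lambda2_le[where p = "\<lambda>x. p (fst x) (snd x)"])
    show "finite (Sigma U M)" using U(1) M(1) by simp
    have "card U = (\<Sum>v\<in>U. 1)" by simp
    also have "\<dots> \<le> (\<Sum>v\<in>U. card (M v))"
      using M by (intro sum_mono) (simp add: Suc_le_eq card_gt_0_iff)
    also have "\<dots> = card (Sigma U M)" using U(1) M(1) by (simp add: card_SigmaI)
    finally show "2 \<le> card (Sigma U M)" using U(2) by simp
    show "0 < p (fst x) (snd x)" if "x \<in> Sigma U M" for x using that p by auto
    show "p (fst x) (snd x) * P x y = p (fst y) (snd y) * P y x"
      if "x \<in> Sigma U M" "y \<in> Sigma U M" for x y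
    proof -
      obtain v c u b where xy: "x = (v, c)" "y = (u, b)" by fastforce
      then have mem: "v \<in> U" "c \<in> M v" "u \<in> U" "b \<in> M u" using that by auto
      show ?thesis
        using rev[OF mem] P[OF mem] P[OF mem(3,4,1,2)] unfolding xy by auto
    qed
    show "(\<Sum>y\<in>Sigma U M. P x y) = 1" if x_in: "x \<in> Sigma U M" for x
    proof -
      obtain v c where x: "x = (v, c)" "v \<in> U" "c \<in> M v" using x_in by auto
      have "(\<Sum>y\<in>Sigma U M. P x y)
          = (\<Sum>u\<in>U. if u = v then 0 else (\<Sum>b\<in>M u. J v c u b) / n)"
        unfolding sum_S x(1) using x(2,3)
        by (intro sum.cong refl) (auto simp: P sum_divide_distrib)
      also have "\<dots> = (\<Sum>u\<in>U - {v}. 1 / n)"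
        unfolding sum_others using J_sum x(2,3) by (intro sum.cong) auto
      also have "\<dots> = 1" using n U x(2) by (simp add: of_nat_diff n_def)
      finally show ?thesis .
    qed
    fix \<mu> h
    assume h: "\<exists>x\<in>Sigma U M. h x \<noteq> 0" "(\<Sum>x\<in>Sigma U M. h x) = 0"
      and eig: "\<And>y. y \<in> Sigma U M \<Longrightarrow> (\<Sum>x\<in>Sigma U M. h x * P x y) = \<mu> * h y"
    have eig': "(\<Sum>v\<in>U - {u}. \<Sum>c\<in>M v. h (v, c) * J v c u b) = n * \<mu> * h (u, b)"
      if "u \<in> U" "b \<in> M u" for u b
      using eig[of "(u, b)"] step[OF that, of h] that n by (simp add: field_simps)
    define H where "H u = (\<Sum>c\<in>M u. h (u, c))" for u
    have H: "n * \<mu> * H u = - H u" if u: "u \<in> U" for u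
    proof -
      have "n * \<mu> * H u = (\<Sum>b\<in>M u. \<Sum>v\<in>U - {u}. \<Sum>c\<in>M v. h (v, c) * J v c u b)"
        unfolding H_def sum_distrib_left using eig'[OF u] by simp
      also have "\<dots> = (\<Sum>v\<in>U - {u}. \<Sum>b\<in>M u. \<Sum>c\<in>M v. h (v, c) * J v c u b)"
        by (rule sum.swap)
      also have "\<dots> = (\<Sum>v\<in>U - {u}. \<Sum>c\<in>M v. \<Sum>b\<in>M u. h (v, c) * J v c u b)"
        by (rule sum.cong[OF refl], rule sum.swap)
      also have "\<dots> = (\<Sum>v\<in>U - {u}. H v)"
      proof (rule sum.cong[OF refl])
        fix v assume "v \<in> U - {u}"
        then have "v \<in> U" "u \<noteq> v" by auto
        then show "(\<Sum>c\<in>M v. \<Sum>b\<in>M u. h (v, c) * J v c u b) = H v"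
          unfolding H_def using J_sum u by (intro sum.cong refl) (simp flip: sum_distrib_left)
      qed
      also have "\<dots> = - H u"
        using h(2) sum.remove[OF U(1) u, of H] unfolding sum_S H_def[symmetric] by simp
      finally show ?thesis .
    qed
    show "\<mu> \<le> I / n"
    proof (cases "\<forall>u\<in>U. H u = 0")
      case False
      then obtain u where u: "u \<in> U" "H u \<noteq> 0" by blast
      \<comment> \<open>A block of nonzero mass forces the eigenvalue \<open>- 1 / n\<close>, which
        is negative and so below the bound.\<close>
      then have "(n * \<mu> + 1) * H u = 0" using H[OF u(1)] by (simp add: algebra_simps)
      then have "n * \<mu> = - 1" using u(2) by simp
      then have "\<mu> \<le> 0" using n mult_nonneg_nonneg[of n \<mu>] by linarith
      also have "0 \<le> I / n" using I n by simp
      finally show ?thesis .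
    next
      case True
      \<comment> \<open>A reference colour per vertex: with all block masses 0, subtracting
        \<open>J v (c0 v) u b\<close> leaves the sum over the block of \<open>v\<close> unchanged
        and turns \<open>J\<close> into influences.\<close>
      define c0 where "c0 v = (SOME c. c \<in> M v)" for v
      have c0: "c0 v \<in> M v" if "v \<in> U" for v
        unfolding c0_def using M(2)[OF that] by (simp add: some_in_eq)
      define S where "S = (\<Sum>v\<in>U. \<Sum>c\<in>M v. \<bar>h (v, c)\<bar>)"
      have "S = (\<Sum>x\<in>Sigma U M. \<bar>h x\<bar>)" unfolding S_def sum_S ..
      moreover obtain x where "x \<in> Sigma U M" "h x \<noteq> 0" using h(1) by blast
      ultimately have S: "0 < S"
        using sum_pos2[of "Sigma U M" x "\<lambda>x. \<bar>h x\<bar>"] U(1) M(1) by simp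
      have block: "\<bar>\<Sum>c\<in>M v. h (v, c) * J v c u b\<bar>
          \<le> (\<Sum>c\<in>M v. \<bar>h (v, c)\<bar> * \<bar>J v c u b - J v (c0 v) u b\<bar>)" if "v \<in> U" for v u b
      proof -
        have "(\<Sum>c\<in>M v. h (v, c) * J v c u b)
            = (\<Sum>c\<in>M v. h (v, c) * (J v c u b - J v (c0 v) u b)) + H v * J v (c0 v) u b"
          unfolding H_def by (simp add: right_diff_distrib sum_subtractf sum_distrib_right)
        then have "\<bar>\<Sum>c\<in>M v. h (v, c) * J v c u b\<bar>
            = \<bar>\<Sum>c\<in>M v. h (v, c) * (J v c u b - J v (c0 v) u b)\<bar>"
          using True that by simp
        also have "\<dots> \<le> (\<Sum>c\<in>M v. \<bar>h (v, c) * (J v c u b - J v (c0 v) u b)\<bar>)" by (rule sum_abs)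
        finally show ?thesis by (simp add: abs_mult)
      qed
      have sum_swap: "(\<Sum>u\<in>U. \<Sum>v\<in>U - {u}. F v u) = (\<Sum>v\<in>U. \<Sum>u\<in>U - {v}. F v u)"
        for F :: "_ \<Rightarrow> _ \<Rightarrow> real"
        unfolding sum_others[symmetric] by (subst sum.swap) (auto intro!: sum.cong)
      \<comment> \<open>The eigenvalue equation is summed in absolute value against the norm
        \<open>S\<close> of \<open>h\<close>. Only an inequality holds, as \<open>\<mu>\<close> may
        be negative.\<close>
      have "n * \<mu> * S \<le> (\<Sum>u\<in>U. \<Sum>b\<in>M u. \<bar>n * \<mu> * h (u, b)\<bar>)"
        unfolding S_def sum_distrib_left
        using n by (intro sum_mono) (simp add: abs_mult mult_right_mono)
      also have "\<dots> = (\<Sum>u\<in>U. \<Sum>b\<in>M u. \<bar>\<Sum>v\<in>U - {u}. \<Sum>c\<in>M v. h (v, c) * J v c u b\<bar>)"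
        using eig' by simp
      also have "\<dots> \<le> (\<Sum>u\<in>U. \<Sum>b\<in>M u. \<Sum>v\<in>U - {u}. \<Sum>c\<in>M v.
          \<bar>h (v, c)\<bar> * \<bar>J v c u b - J v (c0 v) u b\<bar>)"
      proof (intro sum_mono)
        fix u b
        show "\<bar>\<Sum>v\<in>U - {u}. \<Sum>c\<in>M v. h (v, c) * J v c u b\<bar>
          \<le> (\<Sum>v\<in>U - {u}. \<Sum>c\<in>M v. \<bar>h (v, c)\<bar> * \<bar>J v c u b - J v (c0 v) u b\<bar>)"
          by (rule order_trans[OF sum_abs sum_mono]) (simp add: block)
      qed
      also have "\<dots> = (\<Sum>u\<in>U. \<Sum>v\<in>U - {u}. \<Sum>b\<in>M u. \<Sum>c\<in>M v.
          \<bar>h (v, c)\<bar> * \<bar>J v c u b - J v (c0 v) u b\<bar>)"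
        by (rule sum.cong[OF refl], rule sum.swap)
      also have "\<dots> = (\<Sum>v\<in>U. \<Sum>u\<in>U - {v}. \<Sum>b\<in>M u. \<Sum>c\<in>M v.
          \<bar>h (v, c)\<bar> * \<bar>J v c u b - J v (c0 v) u b\<bar>)"
        by (rule sum_swap)
      also have "\<dots> = (\<Sum>v\<in>U. \<Sum>u\<in>U - {v}. \<Sum>c\<in>M v. \<Sum>b\<in>M u.
          \<bar>h (v, c)\<bar> * \<bar>J v c u b - J v (c0 v) u b\<bar>)"
        by (rule sum.cong[OF refl], rule sum.cong[OF refl], rule sum.swap)
      also have "\<dots> = (\<Sum>v\<in>U. \<Sum>c\<in>M v. \<Sum>u\<in>U - {v}. \<Sum>b\<in>M u.
          \<bar>h (v, c)\<bar> * \<bar>J v c u b - J v (c0 v) u b\<bar>)"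
        by (rule sum.cong[OF refl], rule sum.swap)
      also have "\<dots> = (\<Sum>v\<in>U. \<Sum>c\<in>M v. \<bar>h (v, c)\<bar> *
          (\<Sum>u\<in>U - {v}. \<Sum>b\<in>M u. \<bar>J v c u b - J v (c0 v) u b\<bar>))"
        by (simp add: sum_distrib_left)
      also have "\<dots> \<le> (\<Sum>v\<in>U. \<Sum>c\<in>M v. \<bar>h (v, c)\<bar> * I)"
        using influence c0 by (intro sum_mono mult_left_mono) auto
      also have "\<dots> = I * S" unfolding S_def by (simp add: sum_distrib_left mult.commute)
      finally have "n * \<mu> \<le> I" using S by simp
      then show ?thesis using n by (simp add: field_simps)
    qed
  qed
qed

context list_coloring
begin

text \<open>The block walk whose \<open>J\<close> is the conditional marginal given one pinned
  vertex; \<open>influence_le\<close> supplies its influence bound.\<close>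

lemma lambda2_link_le:
  assumes UM: "extra U M" and k: "2 \<le> card U"
    and D: "\<And>u. u \<in> U \<Longrightarrow> card (N u \<inter> U) \<le> D"
    and I: "0 \<le> I" and fix_point: "real D * (1 / \<beta> * (2 + I)) \<le> I"
    and P: "\<And>v c u b. \<lbrakk>v \<in> U; c \<in> M v; u \<in> U; b \<in> M u\<rbrakk> \<Longrightarrow>
          P (v, c) (u, b) = (if v = u then 0 else
            prob (U - {v}) (pin M v c) u b / (real (card U) - 1))"
  shows "lambda2 (Sigma U M) P \<le> I / (real (card U) - 1)"
proof (rule lambda2_block_walk_le[OF _ k _ _ P])
  show "finite U" using UM by (rule extra_finite)
  show "finite (M v)" if "v \<in> U" for v using UM that by (rule extra_finite_list)
  show "M v \<noteq> {}" if "v \<in> U" for v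
  proof -
    have "\<beta> \<le> card (M v)" using UM that by (force simp: extra_def)
    then show ?thesis using \<beta>_pos by auto
  qed
  show "0 \<le> I" by fact
  fix v c assume vc: "v \<in> U" "c \<in> M v"
  have ex: "extra (U - {v}) (pin M v c)" using UM vc(1) by (rule extra_pin')
  \<comment> \<open>This fixes the reversing weight: the number of colourings with colour
    \<open>c\<close> at \<open>v\<close>, proportional to the stationary distribution.\<close>
  show "0 < real (card (colorings (U - {v}) (pin M v c)))" using card_colorings_pos[OF ex] by simp
  show "(\<Sum>b\<in>M u. prob (U - {v}) (pin M v c) u b) = 1" if "u \<in> U" "u \<noteq> v" for u
    using extra_finite_list[OF UM, of u] that
    by (intro sum_prob[OF ex]) (auto simp: pin_def)
  show "(\<Sum>u\<in>U - {v}. \<Sum>b\<in>M u. \<bar>prob (U - {v}) (pin M v c) u b -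
      prob (U - {v}) (pin M v c') u b\<bar>) \<le> I" if c': "c' \<in> M v" for c'
  proof -
    have "(\<Sum>u\<in>U - {v}. \<Sum>b\<in>M u. \<bar>prob (U - {v}) (pin M v c) u b -
      prob (U - {v}) (pin M v c') u b\<bar>) \<le> dist1 (U - {v}) (pin M v c) (pin M v c')"
      unfolding dist1_def using extra_subset[OF UM] finite_C
      by (intro sum_mono sum_mono2) auto
    also have "\<dots> \<le> I" using I fix_point UM D vc c' by (rule influence_le)
    finally show ?thesis .
  qed
  fix u b assume ub: "u \<in> U" "b \<in> M u" "u \<noteq> v"
  \<comment> \<open>Both sides of the reversibility condition count the colourings with
    \<open>c\<close> at \<open>v\<close> and \<open>b\<close> at \<open>u\<close>.\<close>
  have weight: "real (card (colorings (U - {v}) (pin M v c))) * prob (U - {v}) (pin M v c) u b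
      = card {\<sigma> \<in> colorings U M. \<sigma> v = c \<and> \<sigma> u = b}"
    if "v \<in> U" "c \<in> M v" "u \<in> U" "u \<noteq> v" for v c u b
    using card_pin2[of v U c M u b] card_colorings_pos[OF extra_pin'[OF UM that(1), of c]] that
    by (simp add: prob_def)
  show "real (card (colorings (U - {v}) (pin M v c))) * prob (U - {v}) (pin M v c) u b
      = real (card (colorings (U - {u}) (pin M u b))) * prob (U - {u}) (pin M u b) v c"
    using weight[OF vc ub(1,3), of b] weight[OF ub(1,2) vc(1) ub(3)[symmetric], of c]
    by (simp add: conj_commute)
qed

end

section \<open>Links of the colouring complex\<close>

definition nbrs :: "'v set set \<Rightarrow> 'v \<Rightarrow> 'v set" where
  "nbrs E v = {u. {u, v} \<in> E}"

text \<open>A face lies in a facet, so it is the graph of some proper colouring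
  \<open>\<sigma>0\<close> restricted to a vertex set \<open>T\<close>.\<close>

locale pinned_coloring =
  fixes V :: "'v set" and E :: "'v set set" and q :: nat and L :: "'v \<Rightarrow> nat set"
    and \<beta> :: real and \<sigma>0 :: "'v \<Rightarrow> nat" and T :: "'v set"
  assumes inst: "list_coloring_instance V E q L"
    and extra_color: "extra_color V E L \<beta>"
    and \<beta>_gt0: "0 < \<beta>"
    and \<sigma>0: "\<sigma>0 \<in> proper_colorings V E q L"
    and T: "T \<subseteq> V"
begin

lemma edgeD: "{u, v} \<in> E \<Longrightarrow> u \<in> V \<and> v \<in> V \<and> u \<noteq> v"
  using inst by (fastforce simp: list_coloring_instance_def simple_graph_def)

lemma finite_V: "finite V"
  using inst by (simp add: list_coloring_instance_def simple_graph_def)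

lemma L_subset: "v \<in> V \<Longrightarrow> L v \<subseteq> {1..q}"
  using inst by (simp add: list_coloring_instance_def)

sublocale list_coloring "nbrs E" "{1..q}" \<beta>
proof
  show "u \<in> nbrs E v \<longleftrightarrow> v \<in> nbrs E u" for u v by (simp add: nbrs_def insert_commute)
  show "v \<notin> nbrs E v" for v using edgeD[of v v] by (auto simp: nbrs_def)
  show "0 < \<beta>" by (rule \<beta>_gt0)
qed simp

definition free :: "'v set" where "free = V - T"

definition face :: "('v \<times> nat) set" where "face = (\<lambda>v. (v, \<sigma>0 v)) ` T"

definition lists :: "'v \<Rightarrow> nat set" where "lists w = L w - \<sigma>0 ` (nbrs E w \<inter> T)"

definition extend :: "('v \<Rightarrow> nat) \<Rightarrow> ('v \<times> nat) set" where
  "extend \<rho> = face \<union> (\<lambda>v. (v, \<rho> v)) ` free"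

lemma mem_extend: "v \<in> free \<Longrightarrow> (v, c) \<in> extend \<rho> \<longleftrightarrow> \<rho> v = c"
  by (auto simp: extend_def face_def free_def)

text \<open>A pinned neighbour removes at most one colour from the list, and it also no longer
  counts towards the degree inside \<open>free\<close>.\<close>

lemma extra_lists: "extra free lists"
  unfolding extra_def
proof (intro conjI ballI)
  show "finite free" using finite_V by (simp add: free_def)
  fix w assume w: "w \<in> free"
  then have wV: "w \<in> V" by (simp add: free_def)
  show "lists w \<subseteq> {1..q}" using L_subset[OF wV] by (auto simp: lists_def)
  have nV: "nbrs E w \<subseteq> V" using edgeD by (auto simp: nbrs_def)
  then have fin: "finite (nbrs E w)" using finite_V finite_subset by metis
  have "nbrs E w = (nbrs E w \<inter> T) \<union> (nbrs E w \<inter> free)" using nV by (auto simp: free_def)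
  then have "card (nbrs E w) = card (nbrs E w \<inter> T) + card (nbrs E w \<inter> free)"
    using fin by (subst card_Un_disjoint[symmetric]) (auto simp: free_def)
  moreover have "\<beta> + real (card (nbrs E w)) \<le> real (card (L w))"
    using extra_color wV by (simp add: extra_color_def vdeg_def nbrs_def)
  moreover have "card (\<sigma>0 ` (nbrs E w \<inter> T)) \<le> card (nbrs E w \<inter> T)"
    using fin by (intro card_image_le) simp
  moreover have "card (L w) - card (\<sigma>0 ` (nbrs E w \<inter> T)) \<le> card (lists w)"
    unfolding lists_def using fin by (intro diff_card_le_card_Diff) simp
  ultimately show "\<beta> + real (card (nbrs E w \<inter> free)) \<le> real (card (lists w))" by linarith
qed

text \<open>Facets above the face are exactly the completions of \<open>\<sigma>0\<close> on
  \<open>T\<close>. The conditioned facet distribution thereby becomes the uniform distribution on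
  colourings of the residual instance.\<close>

lemma bij_betw_extend:
  "bij_betw extend (colorings free lists) {F \<in> facets V E q L. face \<subseteq> F}"
proof (rule bij_betw_imageI)
  show "inj_on extend (colorings free lists)"
  proof (rule inj_onI)
    fix \<rho> \<rho>' assume \<rho>: "\<rho> \<in> colorings free lists" "\<rho>' \<in> colorings free lists"
      and eq: "extend \<rho> = extend \<rho>'"
    show "\<rho> = \<rho>'"
    proof
      fix v show "\<rho> v = \<rho>' v"
        using \<rho> mem_extend[of v "\<rho> v" \<rho>] mem_extend[of v "\<rho> v" \<rho>'] eq
        by (cases "v \<in> free") (simp_all add: colorings_iff)
    qed
  qed
  have \<sigma>0': "\<And>v. v \<in> V \<Longrightarrow> \<sigma>0 v \<in> L v" "\<And>u v. {u, v} \<in> E \<Longrightarrow> \<sigma>0 u \<noteq> \<sigma>0 v"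
    using \<sigma>0 by (auto simp: proper_colorings_def)
  show "extend ` colorings free lists = {F \<in> facets V E q L. face \<subseteq> F}"
  proof (intro equalityI subsetI)
    fix F assume "F \<in> extend ` colorings free lists"
    then obtain \<rho> where \<rho>: "\<rho> \<in> colorings free lists" and F: "F = extend \<rho>" by blast
    define \<sigma> where "\<sigma> v = (if v \<in> T then \<sigma>0 v else \<rho> v)" for v
    have \<rho>_in: "\<rho> v \<in> lists v" if "v \<in> free" for v using \<rho> that by (simp add: colorings_iff)
    have \<sigma>_in: "\<sigma> v \<in> L v" if "v \<in> V" for v
      using that \<rho>_in[of v] \<sigma>0'(1) by (auto simp: \<sigma>_def lists_def free_def)
    \<comment> \<open>Edges between \<open>T\<close> and \<open>free\<close> are respected because
      \<open>lists\<close> omits the colours of pinned neighbours.\<close>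
    have mixed: "\<sigma>0 u \<noteq> \<rho> v" if "{u, v} \<in> E" "u \<in> T" "v \<notin> T" for u v
    proof -
      have "u \<in> nbrs E v \<inter> T" "v \<in> free"
        using that edgeD[OF that(1)] by (simp_all add: nbrs_def free_def)
      then show ?thesis using \<rho>_in[of v] unfolding lists_def by (metis DiffD2 imageI)
    qed
    have "\<sigma> u \<noteq> \<sigma> v" if e: "{u, v} \<in> E" for u v
    proof -
      have e': "{v, u} \<in> E" using e by (simp add: insert_commute)
      have "\<rho> u \<noteq> \<rho> v" if "u \<notin> T" "v \<notin> T"
        using \<rho> edgeD[OF e] e' that by (auto simp: colorings_iff free_def nbrs_def)
      then show ?thesis
        using mixed[OF e] mixed[OF e'] \<sigma>0'(2)[OF e] by (auto simp: \<sigma>_def)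
    qed
    moreover have "\<sigma> v = undefined" if "v \<notin> V" for v
      using that T \<rho> by (auto simp: \<sigma>_def colorings_iff free_def)
    moreover have "\<sigma> v \<in> {1..q}" if "v \<in> V" for v using \<sigma>_in[OF that] L_subset[OF that] by blast
    ultimately have "\<sigma> \<in> proper_colorings V E q L"
      using \<sigma>_in by (simp add: proper_colorings_def PiE_iff extensional_def)
    moreover have "F = (\<lambda>v. (v, \<sigma> v)) ` V"
      unfolding F extend_def face_def \<sigma>_def free_def using T by auto
    ultimately show "F \<in> {F \<in> facets V E q L. face \<subseteq> F}"
      unfolding facets_def using F by (auto simp: extend_def)
  next
    fix F assume "F \<in> {F \<in> facets V E q L. face \<subseteq> F}"
    then obtain \<sigma> where \<sigma>: "\<sigma> \<in> proper_colorings V E q L" and F: "F = (\<lambda>v. (v, \<sigma> v)) ` V"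
      and sub: "face \<subseteq> F" by (auto simp: facets_def)
    have agree: "\<sigma>0 v = \<sigma> v" if "v \<in> T" for v
      using sub that unfolding F face_def by auto
    have \<sigma>_in: "\<sigma> v \<in> L v" if "v \<in> V" for v using \<sigma> that by (simp add: proper_colorings_def)
    have \<sigma>_ne: "\<sigma> u \<noteq> \<sigma> v" if "{u, v} \<in> E" for u v using \<sigma> that by (simp add: proper_colorings_def)
    have \<sigma>_ne': "\<sigma> u \<noteq> \<sigma> w" if "w \<in> nbrs E u" for u w
      using \<sigma>_ne[of w u] that by (auto simp: nbrs_def)
    have "\<sigma> w \<notin> \<sigma>0 ` (nbrs E w \<inter> T)" for w
      using agree \<sigma>_ne by (force simp: nbrs_def)
    then have "restrict \<sigma> free \<in> colorings free lists"
      using \<sigma>_in \<sigma>_ne' by (simp add: colorings_iff lists_def free_def)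
    moreover have "F = extend (restrict \<sigma> free)"
    proof -
      have "F = (\<lambda>v. (v, \<sigma> v)) ` T \<union> (\<lambda>v. (v, \<sigma> v)) ` free"
        unfolding F image_Un[symmetric] using T by (simp add: free_def Un_absorb1)
      moreover have "(\<lambda>v. (v, \<sigma> v)) ` T = face"
        unfolding face_def using agree by (intro image_cong) simp_all
      moreover have "(\<lambda>v. (v, \<sigma> v)) ` free = (\<lambda>v. (v, restrict \<sigma> free v)) ` free"
        by (intro image_cong) simp_all
      ultimately show ?thesis by (simp only: extend_def)
    qed
    ultimately show "F \<in> extend ` colorings free lists" by blast
  qed
qed

lemma card_facets_above:
  "card {F \<in> facets V E q L. face \<subseteq> F \<and> Q F} = card {\<rho> \<in> colorings free lists. Q (extend \<rho>)}"
proof -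
  have "{F \<in> facets V E q L. face \<subseteq> F \<and> Q F} = extend ` {\<rho> \<in> colorings free lists. Q (extend \<rho>)}"
  proof -
    have "{F \<in> facets V E q L. face \<subseteq> F \<and> Q F} = {F \<in> extend ` colorings free lists. Q F}"
      unfolding bij_betw_imp_surj_on[OF bij_betw_extend] by auto
    then show ?thesis by auto
  qed
  moreover have "inj_on extend {\<rho> \<in> colorings free lists. Q (extend \<rho>)}"
    using bij_betw_imp_inj_on[OF bij_betw_extend] by (rule inj_on_subset) auto
  ultimately show ?thesis by (simp add: card_image)
qed

lemma finite_facets: "finite (facets V E q L)"
proof -
  have "finite (V \<rightarrow>\<^sub>E {1..q})" using finite_V by (intro finite_PiE) auto
  then show ?thesis unfolding facets_def proper_colorings_def by simp
qed

text \<open>Every colour of a residual list really occurs: pinning it leaves an instance with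
  surplus, which has a colouring.\<close>

lemma link_vertices_eq: "link_vertices V E q L face = Sigma free lists"
proof (intro equalityI subsetI)
  fix x assume "x \<in> link_vertices V E q L face"
  then obtain F where x: "x \<notin> face" and F: "F \<in> facets V E q L" "face \<subseteq> F" "x \<in> F"
    by (auto simp: link_vertices_def coloring_complex_def)
  then obtain \<rho> where \<rho>: "\<rho> \<in> colorings free lists" "F = extend \<rho>"
    using bij_betw_imp_surj_on[OF bij_betw_extend] by blast
  then obtain v where "v \<in> free" "x = (v, \<rho> v)" using x F by (auto simp: extend_def)
  then show "x \<in> Sigma free lists" using \<rho>(1) by (simp add: colorings_iff)
next
  fix x assume "x \<in> Sigma free lists"
  then obtain v c where x: "x = (v, c)" "v \<in> free" "c \<in> lists v" by auto
  have "0 < card {\<rho> \<in> colorings free lists. \<rho> v = c}"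
    using card_pin[of v free c lists] x card_colorings_pos[OF extra_pin'[OF extra_lists x(2), of c]]
    by simp
  then have "{\<rho> \<in> colorings free lists. \<rho> v = c} \<noteq> {}" by (metis card.empty less_irrefl)
  then obtain \<rho> where \<rho>: "\<rho> \<in> colorings free lists" "\<rho> v = c" by blast
  have "extend \<rho> \<in> facets V E q L" "face \<subseteq> extend \<rho>"
    using bij_betw_imp_surj_on[OF bij_betw_extend] \<rho>(1) by auto
  moreover have "x \<in> extend \<rho>" using x \<rho> by (simp add: mem_extend)
  moreover have "x \<notin> face" using x by (auto simp: face_def free_def)
  ultimately show "x \<in> link_vertices V E q L face"
    unfolding link_vertices_def coloring_complex_def by auto
qed

lemma codim_face: "codim V face = card free"
proof -
  have "card face = card T" unfolding face_def by (rule card_image) (simp add: inj_on_def)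
  then show ?thesis
    using T finite_V by (simp add: codim_def free_def card_Diff_subset finite_subset)
qed

text \<open>The conditional probability is a quotient of facet counts. These become counts of
  residual colourings, and pinning \<open>v\<close> turns their quotient into a marginal.\<close>

lemma local_walk_eq:
  assumes vc: "v \<in> free" "c \<in> lists v" and ub: "u \<in> free"
  shows "local_walk V E q L face (v, c) (u, b) = (if v = u then 0 else
           prob (free - {v}) (pin lists v c) u b / (real (card free) - 1))"
proof (cases "(v, c) = (u, b)")
  case True
  then show ?thesis by (simp add: local_walk_def)
next
  case False
  let ?M = "measure_pmf (facet_pmf V E q L)"
  let ?x = "(v, c)" and ?y = "(u, b)"
  have ne: "facets V E q L \<noteq> {}" using \<sigma>0 by (auto simp: facets_def)
  have count: "measure ?M {F. Q F} = card {F \<in> facets V E q L. Q F} / card (facets V E q L)" for Q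
    unfolding facet_pmf_def using ne finite_facets by (simp add: measure_pmf_of_set Int_def)
  have "\<P>(F in ?M. ?y \<in> F \<bar> face \<union> {?x} \<subseteq> F)
      = card {F \<in> facets V E q L. ?y \<in> F \<and> face \<union> {?x} \<subseteq> F} / card {F \<in> facets V E q L. face \<union> {?x} \<subseteq> F}"
    using ne finite_facets by (simp add: cond_prob_def count)
  also have "{F \<in> facets V E q L. ?y \<in> F \<and> face \<union> {?x} \<subseteq> F}
      = {F \<in> facets V E q L. face \<subseteq> F \<and> ?x \<in> F \<and> ?y \<in> F}" by auto
  also have "{F \<in> facets V E q L. face \<union> {?x} \<subseteq> F}
      = {F \<in> facets V E q L. face \<subseteq> F \<and> ?x \<in> F}" by auto
  finally have cond: "\<P>(F in ?M. ?y \<in> F \<bar> face \<union> {?x} \<subseteq> F)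
      = card {\<rho> \<in> colorings free lists. \<rho> v = c \<and> \<rho> u = b} / card {\<rho> \<in> colorings free lists. \<rho> v = c}"
    using vc ub by (simp add: card_facets_above mem_extend)
  have walk: "local_walk V E q L face ?x ?y = 1 / (real (card free) - 1) *
      (card {\<rho> \<in> colorings free lists. \<rho> v = c \<and> \<rho> u = b} / card {\<rho> \<in> colorings free lists. \<rho> v = c})"
    unfolding local_walk_def codim_face cond by (simp only: False if_False)
  show ?thesis
  proof (cases "v = u")
    case True
    \<comment> \<open>Two different colours at one vertex never occur together, so the transition
      probability is 0.\<close>
    then have empty: "{\<rho> \<in> colorings free lists. \<rho> v = c \<and> \<rho> u = b} = {}" using False by auto
    show ?thesis unfolding walk empty using True by simp
  next
    case neq: False
    then show ?thesis
      using walk card_pin[of v free c lists] card_pin2[of v free c lists u b] vc ub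
      by (simp add: prob_def)
  qed
qed

end

theorem theorem4p3:
  fixes V :: "'v set" and E :: "'v set set" and L :: "'v \<Rightarrow> nat set"
    and q k :: nat and \<epsilon> :: real and \<tau> :: "('v \<times> nat) set"
  assumes "0 < \<epsilon>" and "\<epsilon> \<le> 1"
    and "list_coloring_instance V E q L"
    and "extra_color V E L ((1 + \<epsilon>) * real (max_deg V E))"
    and "0 < max_deg V E"
    and "(ln (real (max_deg V E)) + 2) / real (max_deg V E) \<le> \<epsilon>\<^sup>2 / 40"
    and "2 \<le> k" and "k \<le> card V"
    and "\<tau> \<in> coloring_complex V E q L" and "codim V \<tau> = k"
  shows "lambda2 (link_vertices V E q L \<tau>) (local_walk V E q L \<tau>) \<le> (5 / (2 * \<epsilon>)) / (real k - 1)"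
proof -
  obtain \<sigma> where \<sigma>: "\<sigma> \<in> proper_colorings V E q L" "\<tau> \<subseteq> (\<lambda>v. (v, \<sigma> v)) ` V"
    using assms(9) by (auto simp: coloring_complex_def facets_def)
  define D where "D = max_deg V E"
  define \<beta> where "\<beta> = (1 + \<epsilon>) * real D"
  have D: "0 < D" using assms(5) by (simp add: D_def)
  have \<beta>: "0 < \<beta>" using D assms(1) by (simp add: \<beta>_def)
  interpret pinned_coloring V E q L \<beta> \<sigma> "fst ` \<tau>"
    using assms(3,4) \<beta> \<sigma> by unfold_locales (auto simp: \<beta>_def D_def)
  have face: "face = \<tau>" using \<sigma>(2) by (force simp: face_def)
  have card_free: "card free = k" using codim_face assms(10) by (simp add: face)
  have deg: "card (nbrs E u \<inter> free) \<le> D" if "u \<in> free" for u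
  proof -
    have "finite (nbrs E u)"
      by (rule finite_subset[OF _ finite_V]) (use edgeD in \<open>auto simp: nbrs_def\<close>)
    then have "card (nbrs E u \<inter> free) \<le> vdeg E u"
      unfolding vdeg_def nbrs_def[symmetric] by (intro card_mono) auto
    also have "\<dots> \<le> D"
      unfolding D_def max_deg_def using finite_V that by (intro Max_ge) (auto simp: free_def)
    finally show ?thesis .
  qed
  have "lambda2 (link_vertices V E q L \<tau>) (local_walk V E q L \<tau>) \<le> (2 / \<epsilon>) / (real (card free) - 1)"
    unfolding link_vertices_eq[unfolded face]
  proof (rule lambda2_link_le[OF extra_lists _ deg])
    show "2 \<le> card free" using card_free assms(7) by simp
    show "0 \<le> 2 / \<epsilon>" using assms(1) by simp
    \<comment> \<open>The value \<open>I = 2 / \<epsilon>\<close> solves the fixed point condition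
      with equality, since \<open>\<beta> = (1 + \<epsilon>) * real D\<close>.\<close>
    have eq: "2 + 2 / \<epsilon> = 2 / \<epsilon> * (1 + \<epsilon>)" using assms(1) by (simp add: field_simps)
    have "real D * (1 / \<beta> * (2 / \<epsilon> * (1 + \<epsilon>))) = 2 / \<epsilon> * ((1 + \<epsilon>) * real D / \<beta>)"
      by (simp only: divide_inverse mult_1 mult_ac)
    also have "\<dots> = 2 / \<epsilon>" unfolding \<beta>_def[symmetric] using \<beta> by simp
    finally show "real D * (1 / \<beta> * (2 + 2 / \<epsilon>)) \<le> 2 / \<epsilon>" unfolding eq by (rule eq_refl)
  qed (assumption, rule local_walk_eq[unfolded face])
  \<comment> \<open>The claimed constant \<open>5 / 2\<close> leaves room above the constant 2
    obtained here.\<close>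
  also have "\<dots> \<le> (5 / (2 * \<epsilon>)) / (real k - 1)"
    unfolding card_free using assms(1,7) by (intro divide_right_mono) (simp_all add: field_simps)
  finally show ?thesis .
qed

end
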